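(* Let $f_1,\dots,f_n:\mathbb{R}^d\to\mathbb{R}$ be convex and twice differentiable, let $f=\frac1n\sum_{i=1}^n f_i$, and suppose there are constants $0<\lambda\le\Lambda$ such that $\lambda I\preceq\nabla^2 f_T(x)\preceq\Lambda I$ for all $x\in\mathbb{R}^d$ and all (nonempty) $T\subseteq[n]$, where $f_T=\frac{1}{|T|}\sum_{i\in T}f_i$. Let $w_*$ be the unique minimizer of $f$. Let $(w_k)_{k\ge0}$ be the outer iterates of the limited-memory Stochastic Block BFGS Method described in the context, run with stepsize $\eta>0$, inner loop length $m$, and with $w_{k+1}$ chosen uniformly at random among the inner iterates $x_1,\dots,x_m$. Let $0<\gamma\le\Gamma$ be constants such that every metric matrix $H_t$ generated by the method satisfies $\gamma I\preceq H_t\preceq\Gamma I$. Assume that $\eta<\gamma\lambda/(2\Gamma^2\Lambda^2)$ and that $m$ is chosen large enough to satisfy $$m\ge\frac{1}{2\eta\left(\gamma\lambda-\eta\Gamma^2\Lambda(2\Lambda-\lambda)\right)}.$$ Then for all $k\ge0$, $$\mathbb{E}\left[f(w_k)-f(w_* )\right]\le\rho^k\,\mathbb{E}\left[f(w_0)-f(w_* )\right],$$ where the convergence rate is $$\rho=\frac{\frac{1}{2m\eta}+\eta\Gamma^2\Lambda(\Lambda-\lambda)}{\gamma\lambda-\eta\Gamma^2\Lambda^2}<1.$$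
   Context: Notation: $[n]=\{1,\dots,n\}$; for nonempty $S\subseteq[n]$, $f_S(x)=\frac{1}{|S|}\sum_{i\in S}f_i(x)$; $A\preceq B$ means $B-A$ is positive semidefinite. Limited-memory Stochastic Block BFGS Method. Inputs: $w_0\in\mathbb{R}^d$, stepsize $\eta>0$, subsample size $s$, sketch size $q$, inner loop length $m$, memory $M$. For $k=0,1,2,\dots$: 1. Compute $\mu=\nabla f(w_k)$ and set $x_0=w_k$. 2. For $t=0,\dots,m-1$: (i) sample subsets $S_t,T_t\subseteq[n]$ uniformly at random, independently of each other; (ii) set $g_t=\nabla f_{S_t}(x_t)-\nabla f_{S_t}(x_0)+\mu$; (iii) form a (random) sketching matrix $D_t\in\mathbb{R}^{d\times q}$ of rank $q$; (iv) set $Y_t=\nabla^2 f_{T_t}(x_t)D_t$ and $\Delta_t=(D_t^TY_t)^{-1}$; (v) let $H_t$ be the matrix obtained by starting from the identity matrix $I$ and applying, in chronological order (oldest first), the block BFGS updates $$H\mapsto (I-D\Delta Y^T)\,H\,(I-Y\Delta D^T)+D\Delta D^T$$ for the $M$ most recently computed triples $(D,Y,\Delta)$, including the current triple $(D_t,Y_t,\Delta_t)$ (for all triples computed so far, if there are fewer than $M$); (vi) set $x_{t+1}=x_t-\eta H_tg_t$. 3. Set $w_{k+1}=x_i$, where $i$ is selected uniformly at random from $\{1,\dots,m\}$. Under the assumed Hessian bounds, constants $0<\gamma\le\Gamma$ with $\gamma I\preceq H_t\preceq\Gamma I$ for all metric matrices $H_t$ generated by the method exist. By the assumption on $\eta$,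 the lower bound required of $m$ is nonnegative. The expectation is over all the randomness in the method.
   Formalization: The claim ρ<1 fails when m equals its lower bound (then ρ=1), so ρ≤1 is proved in general and ρ<1 when m is strictly larger; the expectation bound is proved for all m allowed. S_t is read as independent of D_t, T_t and all earlier choices. *)

theory Defs
  imports "HOL-Probability.Probability"
begin

section \<open>Gradients, Hessians and the Loewner order\<close>

definition gradient :: "(real^'d \<Rightarrow> real) \<Rightarrow> real^'d \<Rightarrow> real^'d" where
  "gradient F x = (THE g. GDERIV F x :> g)"

definition hessian :: "(real^'d \<Rightarrow> real) \<Rightarrow> real^'d \<Rightarrow> real^'d^'d" where
  "hessian F x = jacobian (gradient F) (at x)"

definition twice_differentiable :: "(real^'d \<Rightarrow> real) \<Rightarrow> bool" where
  "twice_differentiable F \<longleftrightarrow>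
     (\<forall>x. F differentiable (at x)) \<and> (\<forall>x. gradient F differentiable (at x))"

definition pos_semidef :: "real^'d^'d \<Rightarrow> bool" where
  "pos_semidef A \<longleftrightarrow> transpose A = A \<and> (\<forall>x. 0 \<le> x \<bullet> (A *v x))"

definition loewner_le :: "real^'d^'d \<Rightarrow> real^'d^'d \<Rightarrow> bool"  (infix \<open>\<preceq>\<close> 50) where
  "A \<preceq> B \<longleftrightarrow> pos_semidef (B - A)"

definition batch_avg :: "(nat \<Rightarrow> real^'d \<Rightarrow> real) \<Rightarrow> nat set \<Rightarrow> real^'d \<Rightarrow> real" where
  "batch_avg f S x = (\<Sum>i\<in>S. f i x) / real (card S)"


section \<open>The method along one realisation of the random choices\<close>

type_synonym ('d, 'q) triple = "(real^'q^'d) \<times> (real^'q^'d) \<times> (real^'q^'q)"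

fun bfgs_update :: "('d, 'q::finite) triple \<Rightarrow> real^'d^'d \<Rightarrow> real^'d^'d" where
  "bfgs_update (D, Y, \<Delta>) H =
     (mat 1 - D ** \<Delta> ** transpose Y) ** H ** (mat 1 - Y ** \<Delta> ** transpose D)
       + D ** \<Delta> ** transpose D"

text \<open>Triples are kept newest first, so \<^const>\<open>take\<close> selects the most recent ones (all of
  them if there are fewer than \<open>M\<close>), and \<^const>\<open>foldr\<close> applies the oldest of these first.\<close>

definition metric_of :: "nat \<Rightarrow> ('d, 'q::finite) triple list \<Rightarrow> real^'d^'d" where
  "metric_of M hs = foldr bfgs_update (take M hs) (mat 1)"

text \<open>A state consists of the current inner iterate and all triples computed so far; \<open>w\<close> is the
  reference point \<open>x\<^sub>0\<close> of the current outer iteration.\<close>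

type_synonym ('d, 'q) state = "(real^'d) \<times> ('d, 'q) triple list"

definition inner_step ::
  "(nat \<Rightarrow> real^'d \<Rightarrow> real) \<Rightarrow> nat \<Rightarrow> real \<Rightarrow> nat \<Rightarrow> real^'d
    \<Rightarrow> nat set \<Rightarrow> nat set \<Rightarrow> real^'q^'d
    \<Rightarrow> ('d, 'q) state \<Rightarrow> ('d, 'q) state" where
  "inner_step f n \<eta> M w S T D = (\<lambda>(x, hs).
     let g = gradient (batch_avg f S) x - gradient (batch_avg f S) w
               + gradient (batch_avg f {1..n}) w;
         Y = hessian (batch_avg f T) x ** D;
         \<Delta> = matrix_inv (transpose D ** Y);
         hs' = (D, Y, \<Delta>) # hs
     in (x - \<eta> *\<^sub>R (metric_of M hs' *v g), hs'))"

primrec inner_state ::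
  "(nat \<Rightarrow> real^'d \<Rightarrow> real) \<Rightarrow> nat \<Rightarrow> real \<Rightarrow> nat \<Rightarrow> ('d, 'q) state
    \<Rightarrow> (nat \<Rightarrow> nat set) \<Rightarrow> (nat \<Rightarrow> nat set) \<Rightarrow> (nat \<Rightarrow> real^'q^'d)
    \<Rightarrow> nat \<Rightarrow> ('d, 'q) state" where
  "inner_state f n \<eta> M w_hs S T D 0 = w_hs"
| "inner_state f n \<eta> M w_hs S T D (Suc t) =
     inner_step f n \<eta> M (fst w_hs) (S t) (T t) (D t) (inner_state f n \<eta> M w_hs S T D t)"

text \<open>The chosen index selects only the next outer iterate; the memory keeps the triples of all
  \<open>m\<close> inner steps and is not reset between outer iterations.\<close>

primrec outer_state ::
  "(nat \<Rightarrow> real^'d \<Rightarrow> real) \<Rightarrow> nat \<Rightarrow> real \<Rightarrow> nat \<Rightarrow> nat \<Rightarrow> real^'d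
    \<Rightarrow> (nat \<Rightarrow> nat \<Rightarrow> nat set) \<Rightarrow> (nat \<Rightarrow> nat \<Rightarrow> nat set) \<Rightarrow> (nat \<Rightarrow> nat \<Rightarrow> real^'q^'d)
    \<Rightarrow> (nat \<Rightarrow> nat) \<Rightarrow> nat \<Rightarrow> ('d, 'q) state" where
  "outer_state f n \<eta> m M w0 S T D I 0 = (w0, [])"
| "outer_state f n \<eta> m M w0 S T D I (Suc k) =
     (let inner = inner_state f n \<eta> M (outer_state f n \<eta> m M w0 S T D I k) (S k) (T k) (D k)
      in (fst (inner (I k)), snd (inner m)))"

definition outer_iterate where
  "outer_iterate f n \<eta> m M w0 S T D I k = fst (outer_state f n \<eta> m M w0 S T D I k)"

text \<open>The matrix used in inner step \<open>t\<close> already includes the triple computed in that step.\<close>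

definition metric_matrix where
  "metric_matrix f n \<eta> m M w0 S T D I k t =
     metric_of M (snd (inner_state f n \<eta> M (outer_state f n \<eta> m M w0 S T D I k)
                         (S k) (T k) (D k) (Suc t)))"


section \<open>The random choices\<close>

definition batches :: "nat \<Rightarrow> nat \<Rightarrow> nat set set" where
  "batches n s = {A. A \<subseteq> {1..n} \<and> card A = s}"

definition earlier_steps :: "nat \<Rightarrow> nat \<Rightarrow> nat \<Rightarrow> (nat \<times> nat) set" where
  "earlier_steps m k t = {(k', t'). t' < m \<and> (k' < k \<or> k' = k \<and> t' < t)}"

text \<open>All random choices made before inner step \<open>t\<close> of outer iteration \<open>k\<close>, as one random variable;
  for \<open>t = m\<close> these are all choices made before the index \<open>I k\<close> is drawn.\<close>

definition history ::
  "(nat \<Rightarrow> nat \<Rightarrow> 'w \<Rightarrow> nat set) \<Rightarrow> (nat \<Rightarrow> nat \<Rightarrow> 'w \<Rightarrow> nat set)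
    \<Rightarrow> (nat \<Rightarrow> nat \<Rightarrow> 'w \<Rightarrow> real^'q^'d) \<Rightarrow> (nat \<Rightarrow> 'w \<Rightarrow> nat) \<Rightarrow> nat \<Rightarrow> nat \<Rightarrow> nat \<Rightarrow> 'w
    \<Rightarrow> (nat \<times> nat \<Rightarrow> nat set \<times> nat set \<times> (real^'q^'d)) \<times> (nat \<Rightarrow> nat)" where
  "history S T D I m k t \<omega> =
     (\<lambda>(k', t')\<in>earlier_steps m k t. (S k' t' \<omega>, T k' t' \<omega>, D k' t' \<omega>), \<lambda>k'\<in>{..<k}. I k' \<omega>)"

definition history_space ::
  "nat \<Rightarrow> nat \<Rightarrow> nat \<Rightarrow> nat \<Rightarrow> nat
    \<Rightarrow> ((nat \<times> nat \<Rightarrow> nat set \<times> nat set \<times> (real^'q^'d)) \<times> (nat \<Rightarrow> nat)) measure" where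
  "history_space n s m k t =
     PiM (earlier_steps m k t)
         (\<lambda>_. count_space (batches n s) \<Otimes>\<^sub>M count_space (batches n s) \<Otimes>\<^sub>M borel)
       \<Otimes>\<^sub>M PiM {..<k} (\<lambda>_. count_space {1..m})"

context prob_space
begin

text \<open>\<^const>\<open>indep_var\<close> requires both random variables to have the same type; this is the same notion
  for random variables of different types.\<close>

definition indep_rv ::
  "'b measure \<Rightarrow> ('a \<Rightarrow> 'b) \<Rightarrow> 'c measure \<Rightarrow> ('a \<Rightarrow> 'c) \<Rightarrow> bool" where
  "indep_rv N X N' X' \<longleftrightarrow> random_variable N X \<and> random_variable N' X' \<and>
     indep_set (sets (vimage_algebra (space M) X N)) (sets (vimage_algebra (space M) X' N'))"

definition uniform_rv :: "'b set \<Rightarrow> ('a \<Rightarrow> 'b) \<Rightarrow> bool" where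
  "uniform_rv A X \<longleftrightarrow> random_variable (count_space A) X \<and>
     distr M (count_space A) X = uniform_count_measure A"

end

text \<open>The sketching matrix \<open>D k t\<close> may have any distribution, and may depend on all earlier random
  choices (hence on the earlier iterates and on \<open>x\<^sub>t\<close>) and on \<open>T k t\<close>, but the sample \<open>S k t\<close> defining
  the stochastic gradient is independent of all of these jointly.\<close>

locale random_choices = prob_space P
  for P :: "'w measure" +
  fixes n s m :: nat
    and S T :: "nat \<Rightarrow> nat \<Rightarrow> 'w \<Rightarrow> nat set"
    and D :: "nat \<Rightarrow> nat \<Rightarrow> 'w \<Rightarrow> real^'q^'d"
    and I :: "nat \<Rightarrow> 'w \<Rightarrow> nat"
  assumes S_uniform: "t < m \<Longrightarrow> uniform_rv (batches n s) (S k t)"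
    and T_uniform: "t < m \<Longrightarrow> uniform_rv (batches n s) (T k t)"
    and D_measurable: "t < m \<Longrightarrow> random_variable borel (D k t)"
    and D_rank: "t < m \<Longrightarrow> AE \<omega> in P. rank (D k t \<omega>) = CARD('q)"
    and I_uniform: "uniform_rv {1..m} (I k)"
    and T_indep: "t < m \<Longrightarrow>
      indep_rv (count_space (batches n s)) (T k t)
               (history_space n s m k t) (history S T D I m k t)"
    and S_indep: "t < m \<Longrightarrow>
      indep_rv (count_space (batches n s)) (S k t)
               (history_space n s m k t \<Otimes>\<^sub>M count_space (batches n s) \<Otimes>\<^sub>M borel)
               (\<lambda>\<omega>. (history S T D I m k t \<omega>, T k t \<omega>, D k t \<omega>))"
    and I_indep:
      "indep_rv (count_space {1..m}) (I k)
                (history_space n s m k m) (history S T D I m k m)"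

end

theory Submission
  imports Defs
begin

text \<open>
  The proof is the variance-reduction argument of SVRG. Write \<open>a\<^sub>t = f(x\<^sub>t) - f(w\<^sub>*)\<close>. Cocoercivity of
  the subsampled gradients bounds the mean of \<open>\<parallel>g\<^sub>t\<parallel>\<^sup>2\<close> over the batches by
  \<open>4\<Lambda>a\<^sub>t + 4(\<Lambda> - \<lambda>)a\<^sub>0\<close>. Since \<open>S\<^sub>t\<close> is independent of \<open>(x\<^sub>t, H\<^sub>t)\<close>, smoothness, the bounds on
  \<open>H\<^sub>t\<close> and gradient domination give \<open>E a\<^sub>t\<^sub>+\<^sub>1 \<le> (1 - c) E a\<^sub>t + b E a\<^sub>0\<close> with
  \<open>c = 2\<eta>(\<gamma>\<lambda> - \<eta>\<Gamma>\<^sup>2\<Lambda>\<^sup>2)\<close> and \<open>b = 2\<eta>\<^sup>2\<Gamma>\<^sup>2\<Lambda>(\<Lambda> - \<lambda>)\<close>. Summing over the inner loop telescopes.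
  Because \<open>c \<le> 1\<close>, the sum over \<open>t = 0..m-1\<close> may be replaced by the one over \<open>t = 1..m\<close>,
  whose mean is \<open>E [f(w\<^sub>k\<^sub>+\<^sub>1) - f(w\<^sub>*)]\<close>; this yields the factor \<open>\<rho> = (1 + mb) / (mc)\<close>.
\<close>

section \<open>Calculus of gradients and Hessians\<close>

text \<open>The \<open>THE\<close> in \<open>gradient\<close> needs existence and uniqueness: the
  adjoint of the derivative, applied to 1, represents it, and a linear functional determines its
  representing vector.\<close>

lemma GDERIV_gradient:
  assumes "F differentiable (at x)"
  shows "GDERIV F x :> gradient F x"
proof -
  obtain F' where F': "(F has_derivative F') (at x)"
    using assms by (auto simp: differentiable_def)
  have "GDERIV F x :> adjoint F' 1"
    using F' adjoint_works[OF has_derivative_linear[OF F'], of _ 1] by (simp add: gderiv_def)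
  moreover have "g = g'" if "GDERIV F x :> g" "GDERIV F x :> g'" for g g'
    using has_derivative_unique[OF that[unfolded gderiv_def]]
    by (metis inner_commute vector_eq_ldot)
  ultimately show ?thesis
    unfolding gradient_def by (metis theI)
qed

lemma gradient_eqI:
  assumes "GDERIV F x :> g"
  shows "gradient F x = g"
proof -
  have "F differentiable (at x)"
    using assms by (auto simp: gderiv_def differentiable_def)
  from GDERIV_gradient[OF this] assms show ?thesis
    unfolding gderiv_def by (metis has_derivative_unique inner_commute vector_eq_ldot)
qed

lemma has_derivative_gradient:
  assumes "twice_differentiable F"
  shows "(gradient F has_derivative (\<lambda>h. hessian F x *v h)) (at x)"
  using assms unfolding twice_differentiable_def hessian_def by (simp flip: jacobian_works)

lemma continuous_on_gradient:
  assumes "twice_differentiable F"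
  shows "continuous_on UNIV (gradient F)"
  using assms unfolding twice_differentiable_def
  by (meson differentiable_imp_continuous_on differentiable_on_def differentiable_at_withinI)

lemma continuous_on_twice_differentiable:
  assumes "twice_differentiable F"
  shows "continuous_on UNIV F"
  using assms unfolding twice_differentiable_def
  by (meson differentiable_imp_continuous_on differentiable_on_def differentiable_at_withinI)

lemma gradient_batch_avg:
  assumes "\<And>i. i \<in> A \<Longrightarrow> twice_differentiable (f i)"
  shows "gradient (batch_avg f A) x = (1 / real (card A)) *\<^sub>R (\<Sum>i\<in>A. gradient (f i) x)"
    and "batch_avg f A differentiable (at x)"
proof -
  have d: "(f i has_derivative (\<lambda>h. h \<bullet> gradient (f i) x)) (at x)" if "i \<in> A" for i
    using assms[OF that] GDERIV_gradient unfolding gderiv_def twice_differentiable_def by blast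
  \<comment> \<open>When \<open>card A = 0\<close>, division by 0 makes both the average and its
    derivative constantly 0.\<close>
  have "((\<lambda>x. (\<Sum>i\<in>A. f i x) / real (card A)) has_derivative
      (\<lambda>h. (\<Sum>i\<in>A. h \<bullet> gradient (f i) x) / real (card A))) (at x)"
    by (cases "card A = 0") (auto intro!: derivative_eq_intros d)
  then have "GDERIV (batch_avg f A) x :> (1 / real (card A)) *\<^sub>R (\<Sum>i\<in>A. gradient (f i) x)"
    by (simp add: gderiv_def batch_avg_def[abs_def] inner_sum_right)
  then show "gradient (batch_avg f A) x = (1 / real (card A)) *\<^sub>R (\<Sum>i\<in>A. gradient (f i) x)"
    and "batch_avg f A differentiable (at x)"
    by (auto intro: gradient_eqI simp: gderiv_def differentiable_def)
qed

lemma twice_differentiable_batch_avg: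
  assumes "\<And>i. i \<in> A \<Longrightarrow> twice_differentiable (f i)"
  shows "twice_differentiable (batch_avg f A)"
proof -
  have "gradient (batch_avg f A) = (\<lambda>x. (1 / real (card A)) *\<^sub>R (\<Sum>i\<in>A. gradient (f i) x))"
    using gradient_batch_avg(1)[OF assms] by auto
  moreover have "(\<lambda>x. \<Sum>i\<in>A. gradient (f i) x) differentiable (at x)" for x
    using assms unfolding twice_differentiable_def 
    by (cases "finite A") (auto intro!: differentiable_sum)
  ultimately show ?thesis
    using gradient_batch_avg(2)[OF assms] unfolding twice_differentiable_def
    by (auto intro!: differentiable_scaleR)
qed

section \<open>Function and gradient estimates from Hessian bounds\<close>

lemma loewner_le_inner:
  assumes "A \<preceq> B"
  shows "x \<bullet> (A *v x) \<le> x \<bullet> (B *v x)"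
  using assms by (auto simp: loewner_le_def pos_semidef_def matrix_vector_mult_diff_rdistrib inner_diff_right)

lemma scaleR_mat_1_mult_vector: "(c *\<^sub>R mat 1) *v x = c *\<^sub>R (x :: real^'d)"
  by (metis scaleR_matrix_vector_assoc matrix_vector_mul_lid)

text \<open>Restriction to the segment from \<open>x\<close> to \<open>y\<close> reduces this to the
  one-variable Lagrange remainder, which asks only for pointwise existence of the second
  derivative.\<close>

lemma taylor_second_order:
  fixes F :: "real^'a \<Rightarrow> real"
  assumes F: "twice_differentiable F"
  obtains z where "F y = F x + gradient F x \<bullet> (y - x) + ((y - x) \<bullet> (hessian F z *v (y - x))) / 2"
proof -
  define p :: "real \<Rightarrow> real^'a" where "p = (\<lambda>t. x + t *\<^sub>R (y - x))"
  define \<phi> where "\<phi> = (\<lambda>k::nat. if k = 0 then (\<lambda>t. F (p t)) else if k = 1 then (\<lambda>t. gradient F (p t) \<bullet> (y - x))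
      else (\<lambda>t. (y - x) \<bullet> (hessian F (p t) *v (y - x))))"
  have p: "(p has_derivative (\<lambda>h. h *\<^sub>R (y - x))) (at t)" for t
    unfolding p_def by (auto intro!: derivative_eq_intros)
  have G: "(F has_derivative (\<lambda>h. h \<bullet> gradient F u)) (at u)" for u
    using GDERIV_gradient[of F u] F by (auto simp: gderiv_def twice_differentiable_def)
  have "(\<phi> 0 has_real_derivative \<phi> 1 t) (at t)" for t
    using diff_chain_at[OF p[of t] G]
    unfolding \<phi>_def has_field_derivative_def
    by (simp add: o_def inner_commute mult.commute[of _ "_ \<bullet> _"])
  moreover have "(\<phi> (Suc 0) has_real_derivative \<phi> 2 t) (at t)" for t
    using has_derivative_inner_left[OF diff_chain_at[OF p[of t] has_derivative_gradient[OF F]], of "y - x"]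
    unfolding \<phi>_def has_field_derivative_def
    by (simp add: o_def inner_commute mult.commute[of _ "_ \<bullet> _"] matrix_vector_mult_scaleR)
  ultimately have "\<forall>k t. k < 2 \<and> 0 \<le> t \<and> t \<le> 1 \<longrightarrow> (\<phi> k has_real_derivative \<phi> (Suc k) t) (at t)"
    by (metis One_nat_def less_2_cases numeral_2_eq_2)
  \<comment> \<open>The conditional locates the Lagrange point for expansion centre 0 and evaluation
    point 1.\<close>
  then have "\<exists>t. (if 1 < (0::real) then 1 < t \<and> t < 0 else 0 < t \<and> t < 1) \<and>
      \<phi> 0 1 = (\<Sum>m<2. (\<phi> m 0 / fact m) * (1 - 0)^m) + (\<phi> 2 t / fact 2) * (1 - 0)^2"
    by (intro Taylor[of 2 \<phi> "\<phi> 0" 0 1 0 1]) auto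
  then obtain t
    where "\<phi> 0 1 = (\<Sum>m<2. (\<phi> m 0 / fact m) * (1 - 0)^m) + (\<phi> 2 t / fact 2) * (1 - 0)^2"
    by blast
  then have "F y = F x + gradient F x \<bullet> (y - x) + ((y - x) \<bullet> (hessian F (p t) *v (y - x))) / 2"
    by (simp add: \<phi>_def p_def lessThan_nat_numeral lessThan_Suc numeral_2_eq_2)
  then show ?thesis by (rule that)
qed

lemma quadratic_lower_bound:
  assumes "twice_differentiable F" "\<And>x. lam *\<^sub>R mat 1 \<preceq> hessian F x"
  shows "F x + gradient F x \<bullet> (y - x) + lam / 2 * (norm (y - x))\<^sup>2 \<le> F y"
proof -
  obtain z where z: "F y = F x + gradient F x \<bullet> (y - x) + ((y - x) \<bullet> (hessian F z *v (y - x))) / 2"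
    using taylor_second_order[OF assms(1)] .
  show ?thesis
    using loewner_le_inner[OF assms(2), of "y - x" z]
    by (simp add: z scaleR_mat_1_mult_vector power2_norm_eq_inner)
qed

lemma quadratic_upper_bound:
  assumes "twice_differentiable F" "\<And>x. hessian F x \<preceq> Lam *\<^sub>R mat 1"
  shows "F y \<le> F x + gradient F x \<bullet> (y - x) + Lam / 2 * (norm (y - x))\<^sup>2"
proof -
  obtain z where z: "F y = F x + gradient F x \<bullet> (y - x) + ((y - x) \<bullet> (hessian F z *v (y - x))) / 2"
    using taylor_second_order[OF assms(1)] .
  show ?thesis
    using loewner_le_inner[OF assms(2), of "y - x" z]
    by (simp add: z scaleR_mat_1_mult_vector power2_norm_eq_inner)
qed

text \<open>The tangent plane at \<open>y\<close> lies below \<open>F\<close> and the quadratic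
  model at \<open>x\<close> lies above it; comparing both at one well-chosen point gives the
  bound.\<close>

lemma gradient_cocoercive:
  assumes F: "twice_differentiable F" and lam: "\<And>x. lam *\<^sub>R mat 1 \<preceq> hessian F x" "0 \<le> lam"
    and Lam: "\<And>x. hessian F x \<preceq> Lam *\<^sub>R mat 1" "0 < Lam"
  shows "(norm (gradient F x - gradient F y))\<^sup>2 \<le> 2 * Lam * (F x - F y - gradient F y \<bullet> (x - y))"
proof -
  define g where "g = gradient F x - gradient F y"
  \<comment> \<open>This point minimises the quadratic model at \<open>x\<close> minus the tangent
    at \<open>y\<close>, so the comparison is sharpest there.\<close>
  define z where "z = x - (1 / Lam) *\<^sub>R g"
  have "F y + gradient F y \<bullet> (z - y) \<le> F z"
    using quadratic_lower_bound[OF F lam(1), of y z] lam(2)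
    by (smt (verit) divide_nonneg_nonneg mult_nonneg_nonneg zero_le_power2)
  also have "\<dots> \<le> F x + gradient F x \<bullet> (z - x) + Lam / 2 * (norm (z - x))\<^sup>2"
    by (rule quadratic_upper_bound[OF F Lam(1)])
  finally have "F y + gradient F y \<bullet> (x - y) - (1 / Lam) * (gradient F y \<bullet> g)
     \<le> F x - (1 / Lam) * (gradient F x \<bullet> g) + (norm g)\<^sup>2 / (2 * Lam)"
    using Lam(2) by (simp add: z_def algebra_simps inner_diff_right power2_eq_square divide_simps)
  moreover have "(1 / Lam) * (gradient F x \<bullet> g) - (1 / Lam) * (gradient F y \<bullet> g) = 2 * ((norm g)\<^sup>2 / (2 * Lam))"
  proof -
    have "gradient F x \<bullet> g - gradient F y \<bullet> g = (norm g)\<^sup>2"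
    by (simp add: g_def power2_norm_eq_inner inner_diff_left)
    then show ?thesis
      by (simp add: diff_divide_distrib[symmetric])
  qed
  ultimately have "(norm g)\<^sup>2 / (2 * Lam) \<le> F x - F y - gradient F y \<bullet> (x - y)"
    by (simp add: algebra_simps)
  then show ?thesis
    using Lam(2) by (simp add: g_def[symmetric] field_simps)
qed

lemma gradient_zero_at_minimum:
  assumes "F differentiable (at x)" "\<And>y. F x \<le> F y"
  shows "gradient F x = 0"
proof -
  have "(F has_derivative (\<lambda>h. h \<bullet> gradient F x)) (at x)"
    using GDERIV_gradient[OF assms(1)] by (simp add: gderiv_def)
  from differential_zero_maxmin[OF _ _ this, of UNIV] assms(2)
  have "(\<lambda>h. h \<bullet> gradient F x) = (\<lambda>h. 0)" by auto
  then show ?thesis by (metis inner_eq_zero_iff)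
qed

text \<open>The Polyak-Lojasiewicz inequality: completing the square minimises the strongly convex
  lower bound at \<open>x\<close> over all displacements.\<close>

lemma gradient_dominated:
  assumes "twice_differentiable F" "\<And>x. lam *\<^sub>R mat 1 \<preceq> hessian F x" "0 < lam"
  shows "2 * lam * (F x - F y) \<le> (norm (gradient F x))\<^sup>2"
proof -
  have "0 \<le> (norm (gradient F x + lam *\<^sub>R (y - x)))\<^sup>2"
    by simp
  also have "\<dots> = (norm (gradient F x))\<^sup>2
      + 2 * lam * (gradient F x \<bullet> (y - x) + lam / 2 * (norm (y - x))\<^sup>2)"
    by (simp only: power2_norm_eq_inner) 
      (simp add: inner_add_left inner_add_right algebra_simps power2_eq_square inner_commute)
  also have "\<dots> \<le> (norm (gradient F x))\<^sup>2 + 2 * lam * (F y - F x)"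
    using quadratic_lower_bound[OF assms(1,2), of x y] assms(3) by simp
  finally show ?thesis by (simp add: algebra_simps)
qed

section \<open>Positive semidefinite matrices\<close>

text \<open>The discriminant argument for the nonnegative form in \<open>u\<close> and
  \<open>v\<close>. Since \<open>A\<close> may be singular, the case where the form vanishes at
  \<open>y\<close> is separate.\<close>

lemma pos_semidef_Cauchy_Schwarz:
  assumes "pos_semidef A"
  shows "(x \<bullet> (A *v y))\<^sup>2 \<le> (x \<bullet> (A *v x)) * (y \<bullet> (A *v y))"
proof -
  define a b c where "a = x \<bullet> (A *v x)" and "b = x \<bullet> (A *v y)" and "c = y \<bullet> (A *v y)"
  have sym: "y \<bullet> (A *v x) = b"
    using assms unfolding pos_semidef_def b_def
    by (metis dot_lmul_matrix inner_commute transpose_matrix_vector)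
  have q: "0 \<le> a * u\<^sup>2 + 2 * b * u * v + c * v\<^sup>2" for u v
  proof -
    have "0 \<le> (u *\<^sub>R x + v *\<^sub>R y) \<bullet> (A *v (u *\<^sub>R x + v *\<^sub>R y))"
      using assms by (simp add: pos_semidef_def)
    also have "\<dots> = a * u\<^sup>2 + 2 * b * u * v + c * v\<^sup>2"
      by (simp add: matrix_vector_right_distrib matrix_vector_mult_scaleR inner_add_left inner_add_right
          sym a_def[symmetric] b_def[symmetric] c_def[symmetric] algebra_simps power2_eq_square)
    finally show ?thesis .
  qed
  have "0 \<le> c" using assms by (simp add: pos_semidef_def c_def)
  have "b\<^sup>2 \<le> a * c"
  proof (cases "c = 0")
    case False
    \<comment> \<open>At \<open>u = c\<close> and \<open>v = - b\<close> the form takes exactly this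
      value.\<close>
    have "0 \<le> c * (a * c - b\<^sup>2)"
      using q[of c "- b"] by (simp add: power2_eq_square algebra_simps)
    then show ?thesis
      using False \<open>0 \<le> c\<close> by (simp add: zero_le_mult_iff)
  next
    case True
    have "b = 0"
    proof (rule ccontr)
      assume "b \<noteq> 0"
      \<comment> \<open>With \<open>c = 0\<close> the form is affine in \<open>v\<close>, and this
        \<open>v\<close> gives the value -1.\<close>
      then show False using q[of 1 "- (a + 1) / (2 * b)"] True by simp
    qed
    then show ?thesis using True by simp
  qed
  then show ?thesis by (simp add: a_def b_def c_def)
qed

text \<open>Cauchy-Schwarz for the form of \<open>H\<close>, applied to \<open>H *v x\<close> and
  \<open>x\<close>, yields the operator bound without diagonalising \<open>H\<close>; one factor of
  the squared norm of \<open>H *v x\<close> cancels.\<close>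

lemma norm_matrix_vector_le_of_loewner:
  assumes lo: "\<gamma> *\<^sub>R mat 1 \<preceq> H" "0 \<le> \<gamma>" and up: "H \<preceq> \<Gamma> *\<^sub>R mat 1"
  shows "(norm (H *v x))\<^sup>2 \<le> \<Gamma>\<^sup>2 * (norm x)\<^sup>2"
proof -
  have le: "u \<bullet> (H *v u) \<le> \<Gamma> * (norm u)\<^sup>2" for u
    using loewner_le_inner[OF up, of u] by (simp add: scaleR_mat_1_mult_vector power2_norm_eq_inner)
  have ge: "0 \<le> u \<bullet> (H *v u)" for u
    using loewner_le_inner[OF lo(1), of u] lo(2)
    by (simp add: scaleR_mat_1_mult_vector) (smt (verit) inner_ge_zero mult_nonneg_nonneg)
  \<comment> \<open>Symmetry of \<open>H\<close> is contained in the Loewner hypothesis, since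
    \<open>pos_semidef\<close> demands a symmetric difference and the identity is symmetric.\<close>
  have "transpose (H - \<gamma> *\<^sub>R mat 1) = H - \<gamma> *\<^sub>R mat 1"
    using lo(1) by (simp add: loewner_le_def pos_semidef_def)
  then have "H $ i $ j = H $ j $ i" for i j
    by (drule_tac arg_cong[where f = "\<lambda>A. A $ i $ j"]) (auto simp: transpose_def mat_def split: if_splits)
  then have "transpose H = H"
    by (simp add: vec_eq_iff transpose_def)
  with ge have psd: "pos_semidef H"
    by (simp add: pos_semidef_def)
  define y where "y = H *v x"
  have "(norm y)\<^sup>2 * (norm y)\<^sup>2 = (y \<bullet> (H *v x))\<^sup>2"
    by (simp add: y_def dot_square_norm power2_eq_square)
  also have "\<dots> \<le> (y \<bullet> (H *v y)) * (x \<bullet> (H *v x))"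
    by (rule pos_semidef_Cauchy_Schwarz[OF psd])
  also have "\<dots> \<le> (\<Gamma> * (norm y)\<^sup>2) * (\<Gamma> * (norm x)\<^sup>2)"
    by (intro mult_mono le ge order_trans[OF ge le])
  also have "\<dots> = (norm y)\<^sup>2 * (\<Gamma>\<^sup>2 * (norm x)\<^sup>2)"
    by (simp add: power2_eq_square algebra_simps)
  finally show ?thesis
    unfolding y_def[symmetric]
    by (metis mult_left_le_imp_le mult_nonneg_nonneg norm_eq_zero zero_le_power2 zero_less_norm_iff zero_less_power zero_power2)
qed

section \<open>Batch means and one inner step\<close>

text \<open>A plain finite average lets batch estimates be proved pointwise, outside any probability
  space. It serves both for batches and for the uniformly drawn inner index.\<close>

definition mean :: "'b set \<Rightarrow> ('b \<Rightarrow> real) \<Rightarrow> real" where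
  "mean A h = (\<Sum>a\<in>A. h a) / real (card A)"

lemma mean_mono: "(\<And>a. a \<in> A \<Longrightarrow> g a \<le> h a) \<Longrightarrow> mean A g \<le> mean A h"
  unfolding mean_def by (intro divide_right_mono sum_mono) auto

lemma mean_cong: "(\<And>a. a \<in> A \<Longrightarrow> g a = h a) \<Longrightarrow> mean A g = mean A h"
  unfolding mean_def by auto

lemma mean_add: "mean A (\<lambda>a. g a + h a) = mean A g + mean A h"
  by (simp add: mean_def sum.distrib add_divide_distrib)

lemma mean_diff: "mean A (\<lambda>a. g a - h a) = mean A g - mean A h"
  by (simp add: mean_def sum_subtractf diff_divide_distrib)

lemma mean_cmult: "mean A (\<lambda>a. c * h a) = c * mean A h"
  by (simp add: mean_def sum_distrib_left)

lemma mean_const: "finite A \<Longrightarrow> A \<noteq> {} \<Longrightarrow> mean A (\<lambda>a. c) = c"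
  by (simp add: mean_def)

text \<open>Turns a bound on the mean into one on each value; this provides integrability for each
  frozen batch.\<close>

lemma le_mean:
  assumes "finite A" "a \<in> A" "\<And>a. a \<in> A \<Longrightarrow> 0 \<le> h a"
  shows "h a \<le> real (card A) * mean A h"
  using assms member_le_sum[of a A h] by (auto simp: mean_def)

section \<open>Counting batches of fixed size\<close>

lemma finite_batches: "finite (batches n s)"
  by (simp add: batches_def)

lemma batches_nonempty: "s \<le> n \<Longrightarrow> batches n s \<noteq> {}"
proof
  assume "s \<le> n" "batches n s = {}"
  then have "card (batches n s) = 0" by simp
  then have "n choose s = 0" using n_subsets[of "{1..n}" s] by (simp only: batches_def) simp
  then show False using \<open>s \<le> n\<close> by simp
qed

text \<open>Removing \<open>i\<close> is a bijection onto the subsets of size \<open>s - 1\<close>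
  of the other \<open>n - 1\<close> indices.\<close>

lemma card_batches_containing:
  assumes "i \<in> {1..n}" "1 \<le> s"
  shows "card {A \<in> batches n s. i \<in> A} = (n - 1) choose (s - 1)"
proof -
  let ?C = "{A. A \<subseteq> {1..n} - {i} \<and> card A = s - 1}"
  have fin: "finite A" if "A \<subseteq> {1..n}" for A
    using that finite_subset by blast
  have "{A \<in> batches n s. i \<in> A} = insert i ` ?C"
  proof (intro equalityI subsetI)
    fix A assume "A \<in> {A \<in> batches n s. i \<in> A}"
    then have "A - {i} \<in> ?C" "A = insert i (A - {i})"
      using fin by (auto simp: batches_def)
    then show "A \<in> insert i ` ?C" by blast
  next
    fix A assume "A \<in> insert i ` ?C"
    then obtain C where "A = insert i C" "C \<subseteq> {1..n} - {i}" "card C = s - 1"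
      by auto
    moreover from this have "finite C" "i \<notin> C" using fin by auto
    ultimately show "A \<in> {A \<in> batches n s. i \<in> A}"
      using assms by (auto simp: batches_def)
  qed
  moreover have "inj_on (insert i) ?C"
    by (intro inj_onI) (metis (no_types, lifting) Diff_insert_absorb mem_Collect_eq subset_Diff_insert)
  moreover have "card ?C = (n - 1) choose (s - 1)"
    using n_subsets[of "{1..n} - {i}" "s - 1"] assms(1) by simp
  ultimately show ?thesis
    by (simp add: card_image)
qed

text \<open>Double counting: every index lies in equally many batches, so all summands receive the
  same weight. This is unbiasedness of sampling without replacement.\<close>

lemma mean_batch_avg:
  assumes "1 \<le> s" "s \<le> n"
  shows "mean (batches n s) (\<lambda>A. batch_avg f A x) = batch_avg f {1..n} x"
proof -
  have "(\<Sum>A\<in>batches n s. \<Sum>i\<in>A. f i x) = (\<Sum>A\<in>batches n s. \<Sum>i\<in>{1..n}. if i \<in> A then f i x else 0)"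
  proof (rule sum.cong[OF refl])
    fix A assume "A \<in> batches n s"
    then have "{1..n} \<inter> A = A" by (auto simp: batches_def)
    then show "(\<Sum>i\<in>A. f i x) = (\<Sum>i\<in>{1..n}. if i \<in> A then f i x else 0)"
      using sum.inter_restrict[of "{1..n}" "\<lambda>i. f i x" A] by simp
  qed
  also have "\<dots> = (\<Sum>i\<in>{1..n}. \<Sum>A\<in>batches n s. if i \<in> A then f i x else 0)"
    by (rule sum.swap)
  also have "\<dots> = (\<Sum>i\<in>{1..n}. real ((n - 1) choose (s - 1)) * f i x)"
  proof (intro sum.cong refl)
    fix i assume "i \<in> {1..n}"
    have "(\<Sum>A\<in>batches n s. if i \<in> A then f i x else 0) = (\<Sum>A\<in>{A \<in> batches n s. i \<in> A}. f i x)"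
      by (rule sum.inter_filter[symmetric]) (rule finite_batches)
    then show "(\<Sum>A\<in>batches n s. if i \<in> A then f i x else 0) = real ((n - 1) choose (s - 1)) * f i x"
      using card_batches_containing[OF \<open>i \<in> {1..n}\<close> assms(1)] by simp
  qed
  finally have *: "(\<Sum>A\<in>batches n s. \<Sum>i\<in>A. f i x)
      = real ((n - 1) choose (s - 1)) * (\<Sum>i\<in>{1..n}. f i x)"
    by (simp add: sum_distrib_left)
  have card: "card (batches n s) = n choose s"
    using n_subsets[of "{1..n}" s] by (simp add: batches_def)
  \<comment> \<open>The absorption identity reduces the common weight to
    \<open>1 / n\<close>.\<close>
  have binom: "real s * real (n choose s) = real n * real ((n - 1) choose (s - 1))"
    using binomial_absorption[of "s - 1" n] assms
    by (simp flip: of_nat_mult) 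
  have "mean (batches n s) (\<lambda>A. batch_avg f A x) = (\<Sum>A\<in>batches n s. \<Sum>i\<in>A. f i x) / (real s * real (n choose s))"
  proof -
    have "(\<Sum>A\<in>batches n s. batch_avg f A x) = (\<Sum>A\<in>batches n s. (\<Sum>i\<in>A. f i x) / real s)"
      by (intro sum.cong refl) (auto simp: batches_def batch_avg_def)
    then show ?thesis by (simp add: mean_def card sum_divide_distrib[symmetric])
  qed
  then show ?thesis
    unfolding * binom using assms by (simp add: batch_avg_def)
qed

section \<open>One step averaged over the gradient batch\<close>

locale finite_sum_minimization =
  fixes f :: "nat \<Rightarrow> real^'d \<Rightarrow> real" and n s :: nat and lam Lam :: real and wstar :: "real^'d"
  assumes batch_size: "1 \<le> s" "s \<le> n"
    and twice_diff: "i \<in> {1..n} \<Longrightarrow> twice_differentiable (f i)"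
    and lam_pos: "0 < lam" and lam_le_Lam: "lam \<le> Lam"
    and hessian_bounds: "A \<subseteq> {1..n} \<Longrightarrow> A \<noteq> {} \<Longrightarrow>
           lam *\<^sub>R mat 1 \<preceq> hessian (batch_avg f A) x \<and> hessian (batch_avg f A) x \<preceq> Lam *\<^sub>R mat 1"
    and wstar_min: "is_arg_min (batch_avg f {1..n}) (\<lambda>_. True) wstar"
begin

abbreviation F where "F \<equiv> batch_avg f {1..n}"
abbreviation grad where "grad A \<equiv> gradient (batch_avg f A)"

definition gap where "gap x = F x - F wstar"

lemma gap_nonneg: "0 \<le> gap x"
  using wstar_min by (auto simp: gap_def is_arg_min_linorder)

lemma Lam_pos: "0 < Lam"
  using lam_pos lam_le_Lam by simp

lemma batchD:
  assumes "A \<in> batches n s"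
  shows "A \<subseteq> {1..n}" "A \<noteq> {}"
  using assms batch_size by (auto simp: batches_def)

lemma full_batch: "{1..n} \<subseteq> {1..n}" "{1..n} \<noteq> {}"
  using batch_size by auto

lemma batch_twice_diff: "A \<subseteq> {1..n} \<Longrightarrow> twice_differentiable (batch_avg f A)"
  by (intro twice_differentiable_batch_avg twice_diff) auto

lemma grad_wstar: "grad {1..n} wstar = 0"
  using batch_twice_diff[OF full_batch(1)] gap_nonneg unfolding gap_def
  by (intro gradient_zero_at_minimum) (auto simp: twice_differentiable_def)

text \<open>Unbiasedness of the batch gradient, tested against a vector because \<open>mean\<close>
  is real-valued; \<open>mean_batch_avg\<close> then applies to the scalar functions.\<close>

lemma mean_grad_inner:
  "mean (batches n s) (\<lambda>A. grad A x \<bullet> v) = grad {1..n} x \<bullet> v"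
proof -
  have "grad A x \<bullet> v = batch_avg (\<lambda>i x. gradient (f i) x \<bullet> v) A x" if "A \<subseteq> {1..n}" for A
    using that twice_diff by (subst gradient_batch_avg) (auto simp: batch_avg_def inner_sum_left)
  then show ?thesis
    using mean_batch_avg[OF batch_size, of "\<lambda>i x. gradient (f i) x \<bullet> v"] batchD(1)
    by (simp cong: mean_cong)
qed

text \<open>After cocoercivity the linear terms average to 0, because the full gradient vanishes at
  \<open>wstar\<close>; the individual batch gradients there may be nonzero.\<close>

lemma mean_norm_grad_diff:
  "mean (batches n s) (\<lambda>A. (norm (grad A x - grad A wstar))\<^sup>2) \<le> 2 * Lam * gap x"
proof -
  have "mean (batches n s) (\<lambda>A. (norm (grad A x - grad A wstar))\<^sup>2)
      \<le> mean (batches n s) (\<lambda>A. 2 * Lam * (batch_avg f A x - batch_avg f A wstar - grad A wstar \<bullet> (x - wstar)))"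
    using hessian_bounds batchD lam_pos Lam_pos batch_twice_diff
    by (intro mean_mono gradient_cocoercive[where lam = lam]) auto
  also have "\<dots> = 2 * Lam * gap x"
    by (simp add: mean_cmult mean_diff mean_grad_inner mean_batch_avg[OF batch_size] grad_wstar gap_def del: One_nat_def)
  finally show ?thesis .
qed

lemma gap_le_norm_grad: "2 * lam * gap x \<le> (norm (grad {1..n} x))\<^sup>2"
  unfolding gap_def
  using hessian_bounds[OF full_batch] lam_pos batch_twice_diff[OF full_batch(1)]
  by (intro gradient_dominated) auto

text \<open>The estimator is \<open>u - (v - ?\<mu>)\<close>, where \<open>u\<close> and
  \<open>v\<close> are the batch gradient differences from \<open>wstar\<close> at \<open>x\<close>
  and \<open>w\<close>. Since \<open>v\<close> averages to \<open>?\<mu>\<close>, the squared norm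
  of \<open>v - ?\<mu>\<close> averages to that of \<open>v\<close> minus that of
  \<open>?\<mu>\<close>. Gradient domination bounds the subtracted term from below and so produces
  the factor \<open>Lam - lam\<close>.\<close>

lemma mean_norm_variance_reduced:
  "mean (batches n s) (\<lambda>A. (norm (grad A x - grad A w + grad {1..n} w))\<^sup>2)
     \<le> 4 * Lam * gap x + 4 * (Lam - lam) * gap w"
proof -
  let ?\<mu> = "grad {1..n} w"
  have ne: "finite (batches n s)" "batches n s \<noteq> {}"
    using finite_batches batches_nonempty batch_size by auto
  have split: "(norm (grad A x - grad A w + ?\<mu>))\<^sup>2 \<le> 2 * (norm (grad A x - grad A wstar))\<^sup>2
      + 2 * ((norm (grad A w - grad A wstar))\<^sup>2 - 2 * (grad A w \<bullet> ?\<mu> - grad A wstar \<bullet> ?\<mu>) + (norm ?\<mu>)\<^sup>2)" for A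
  proof -
    define u v where "u = grad A x - grad A wstar" and "v = grad A w - grad A wstar"
    \<comment> \<open>The term discarded from the parallelogram identity.\<close>
    have "0 \<le> (norm (u + (v - ?\<mu>)))\<^sup>2"
      by simp
    then have "(norm (u - (v - ?\<mu>)))\<^sup>2 \<le> 2 * (norm u)\<^sup>2 + 2 * ((norm v)\<^sup>2 - 2 * (v \<bullet> ?\<mu>) + (norm ?\<mu>)\<^sup>2)"
      unfolding power2_norm_eq_inner
      by (simp add: inner_diff_left inner_diff_right inner_add_left inner_add_right inner_commute)
    moreover have "u - (v - ?\<mu>) = grad A x - grad A w + ?\<mu>"
      by (simp add: u_def v_def)
    moreover have "v \<bullet> ?\<mu> = grad A w \<bullet> ?\<mu> - grad A wstar \<bullet> ?\<mu>"
      by (simp add: v_def inner_diff_left)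
    ultimately show ?thesis
      by (simp only: u_def[symmetric] v_def[symmetric])
  qed
  have "mean (batches n s) (\<lambda>A. (norm (grad A x - grad A w + ?\<mu>))\<^sup>2)
      \<le> 2 * mean (batches n s) (\<lambda>A. (norm (grad A x - grad A wstar))\<^sup>2)
        + 2 * (mean (batches n s) (\<lambda>A. (norm (grad A w - grad A wstar))\<^sup>2) - (norm ?\<mu>)\<^sup>2)"
    using mean_mono[of "batches n s" "\<lambda>A. (norm (grad A x - grad A w + ?\<mu>))\<^sup>2", OF split]
    by (simp add: mean_add mean_cmult mean_diff mean_grad_inner grad_wstar mean_const[OF ne] power2_norm_eq_inner del: One_nat_def)
  also have "\<dots> \<le> 2 * (2 * Lam * gap x) + 2 * (2 * Lam * gap w - 2 * lam * gap w)"
    using mean_norm_grad_diff gap_le_norm_grad by (intro add_mono mult_left_mono diff_mono) auto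
  finally show ?thesis
    by (simp add: algebra_simps)
qed

text \<open>\<open>H\<close> stays fixed while the batch varies, so in the linear smoothness term
  the estimator averages to the full gradient. The lower bound on \<open>H\<close> with gradient
  domination controls that term; the upper bound and the variance estimate control the quadratic
  one.\<close>

lemma mean_gap_step:
  assumes H: "\<gamma> *\<^sub>R mat 1 \<preceq> H" "H \<preceq> \<Gamma> *\<^sub>R mat 1" and "0 \<le> \<gamma>" "0 \<le> \<eta>"
  shows "mean (batches n s) (\<lambda>A. gap (x - \<eta> *\<^sub>R (H *v (grad A x - grad A w + grad {1..n} w))))
    \<le> (1 - 2 * \<eta> * (\<gamma> * lam - \<eta> * \<Gamma>\<^sup>2 * Lam\<^sup>2)) * gap x + 2 * \<eta>\<^sup>2 * \<Gamma>\<^sup>2 * Lam * (Lam - lam) * gap w"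
proof -
  define g where "g A = grad A x - grad A w + grad {1..n} w" for A
  define G where "G = grad {1..n} x"
  have ne: "finite (batches n s)" "batches n s \<noteq> {}"
    using finite_batches batches_nonempty batch_size by auto
  have step: "gap (x - \<eta> *\<^sub>R (H *v g A)) \<le> gap x - \<eta> * (G \<bullet> (H *v g A)) + Lam / 2 * \<eta>\<^sup>2 * \<Gamma>\<^sup>2 * (norm (g A))\<^sup>2" for A
  proof -
    have "F (x - \<eta> *\<^sub>R (H *v g A)) \<le> F x - \<eta> * (G \<bullet> (H *v g A)) + Lam / 2 * (\<eta>\<^sup>2 * (norm (H *v g A))\<^sup>2)"
      using quadratic_upper_bound[of F Lam "x - \<eta> *\<^sub>R (H *v g A)" x]
        hessian_bounds[OF full_batch] batch_twice_diff[OF full_batch(1)]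
      by (simp add: G_def power_mult_distrib)
    also have "Lam / 2 * (\<eta>\<^sup>2 * (norm (H *v g A))\<^sup>2) \<le> Lam / 2 * (\<eta>\<^sup>2 * (\<Gamma>\<^sup>2 * (norm (g A))\<^sup>2))"
      using Lam_pos norm_matrix_vector_le_of_loewner[OF H(1) \<open>0 \<le> \<gamma>\<close> H(2)]
      by (intro mult_left_mono) auto
    finally show ?thesis by (simp add: gap_def algebra_simps)
  qed
  have "mean (batches n s) (\<lambda>A. G \<bullet> (H *v g A)) = G \<bullet> (H *v G)"
  proof -
    \<comment> \<open>Moving \<open>H\<close> onto the fixed vector \<open>G v* H\<close> leaves
      inner products covered by \<open>mean_grad_inner\<close>.\<close>
    have "G \<bullet> (H *v g A) = grad A x \<bullet> (G v* H) - grad A w \<bullet> (G v* H) + grad {1..n} w \<bullet> (G v* H)" for A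
      unfolding dot_lmul_matrix[symmetric] g_def
      by (simp add: inner_add_left inner_diff_left inner_commute[of "G v* H"])
    then show ?thesis
      by (simp add: mean_add mean_diff mean_grad_inner mean_const[OF ne] G_def[symmetric] del: One_nat_def)
        (metis dot_lmul_matrix inner_commute)
  qed
  moreover have "\<gamma> * (2 * lam * gap x) \<le> G \<bullet> (H *v G)"
  proof -
    have "\<gamma> * (2 * lam * gap x) \<le> \<gamma> * (norm G)\<^sup>2"
      unfolding G_def using gap_le_norm_grad \<open>0 \<le> \<gamma>\<close> by (intro mult_left_mono)
    also have "\<dots> \<le> G \<bullet> (H *v G)"
      using loewner_le_inner[OF H(1), of G] by (simp add: scaleR_mat_1_mult_vector power2_norm_eq_inner)
    finally show ?thesis .
  qed
  ultimately have "\<eta> * (\<gamma> * (2 * lam * gap x)) \<le> \<eta> * mean (batches n s) (\<lambda>A. G \<bullet> (H *v g A))"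
    using \<open>0 \<le> \<eta>\<close> by (simp add: mult_left_mono)
  moreover have "mean (batches n s) (\<lambda>A. gap (x - \<eta> *\<^sub>R (H *v g A)))
    \<le> gap x - \<eta> * mean (batches n s) (\<lambda>A. G \<bullet> (H *v g A))
      + Lam / 2 * \<eta>\<^sup>2 * \<Gamma>\<^sup>2 * mean (batches n s) (\<lambda>A. (norm (g A))\<^sup>2)"
  proof -
    have "mean (batches n s) (\<lambda>A. gap (x - \<eta> *\<^sub>R (H *v g A)))
        \<le> mean (batches n s) (\<lambda>A. gap x - \<eta> * (G \<bullet> (H *v g A)) + Lam / 2 * \<eta>\<^sup>2 * \<Gamma>\<^sup>2 * (norm (g A))\<^sup>2)"
      by (rule mean_mono) (rule step)
    also have "\<dots> = gap x - \<eta> * mean (batches n s) (\<lambda>A. G \<bullet> (H *v g A))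
        + Lam / 2 * \<eta>\<^sup>2 * \<Gamma>\<^sup>2 * mean (batches n s) (\<lambda>A. (norm (g A))\<^sup>2)"
      by (simp only: mean_add mean_cmult mean_diff mean_const[OF ne])
    finally show ?thesis .
  qed
  moreover have "Lam / 2 * \<eta>\<^sup>2 * \<Gamma>\<^sup>2 * mean (batches n s) (\<lambda>A. (norm (g A))\<^sup>2)
      \<le> Lam / 2 * \<eta>\<^sup>2 * \<Gamma>\<^sup>2 * (4 * Lam * gap x + 4 * (Lam - lam) * gap w)"
    unfolding g_def using Lam_pos by (intro mult_left_mono mean_norm_variance_reduced) auto
  ultimately have "mean (batches n s) (\<lambda>A. gap (x - \<eta> *\<^sub>R (H *v g A)))
    \<le> gap x - \<eta> * (\<gamma> * (2 * lam * gap x)) + Lam / 2 * \<eta>\<^sup>2 * \<Gamma>\<^sup>2 * (4 * Lam * gap x + 4 * (Lam - lam) * gap w)"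
    by linarith
  also have "\<dots> = (1 - 2 * \<eta> * (\<gamma> * lam - \<eta> * \<Gamma>\<^sup>2 * Lam\<^sup>2)) * gap x + 2 * \<eta>\<^sup>2 * \<Gamma>\<^sup>2 * Lam * (Lam - lam) * gap w"
    by (simp add: algebra_simps power2_eq_square)
  finally show ?thesis unfolding g_def .
qed

end

section \<open>Measurability of the iterates\<close>

lemma borel_measurable_matrix_iff:
  fixes X :: "'w \<Rightarrow> real^'b^'a"
  shows "X \<in> borel_measurable N \<longleftrightarrow> (\<forall>i j. (\<lambda>\<omega>. X \<omega> $ i $ j) \<in> borel_measurable N)"
  unfolding borel_measurable_euclidean_space[of X] by (auto simp: Basis_vec_def inner_axis)

lemma borel_measurable_vector_iff:
  fixes X :: "'w \<Rightarrow> real^'a"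
  shows "X \<in> borel_measurable N \<longleftrightarrow> (\<forall>i. (\<lambda>\<omega>. X \<omega> $ i) \<in> borel_measurable N)"
  unfolding borel_measurable_euclidean_space[of X] by (auto simp: Basis_vec_def inner_axis)

lemma borel_measurable_matrix_mult:
  fixes X :: "'w \<Rightarrow> real^'b^'a" and Y :: "'w \<Rightarrow> real^'c^'b"
  assumes "X \<in> borel_measurable N" "Y \<in> borel_measurable N"
  shows "(\<lambda>\<omega>. X \<omega> ** Y \<omega>) \<in> borel_measurable N"
  using assms unfolding borel_measurable_matrix_iff
  by (auto simp: matrix_matrix_mult_def intro!: borel_measurable_sum borel_measurable_times)

lemma borel_measurable_matrix_vector_mult:
  fixes X :: "'w \<Rightarrow> real^'b^'a" and Y :: "'w \<Rightarrow> real^'b"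
  assumes "X \<in> borel_measurable N" "Y \<in> borel_measurable N"
  shows "(\<lambda>\<omega>. X \<omega> *v Y \<omega>) \<in> borel_measurable N"
  using assms unfolding borel_measurable_matrix_iff borel_measurable_vector_iff
  by (auto simp: matrix_vector_mult_def intro!: borel_measurable_sum borel_measurable_times)

lemma borel_measurable_transpose:
  fixes X :: "'w \<Rightarrow> real^'b^'a"
  assumes "X \<in> borel_measurable N"
  shows "(\<lambda>\<omega>. transpose (X \<omega>)) \<in> borel_measurable N"
  using assms unfolding borel_measurable_matrix_iff by (simp add: transpose_def)

lemma borel_measurable_det:
  fixes X :: "'w \<Rightarrow> real^'a^'a"
  assumes "X \<in> borel_measurable N"
  shows "(\<lambda>\<omega>. det (X \<omega>)) \<in> borel_measurable N"
  using assms unfolding borel_measurable_matrix_iff det_def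
  by (auto intro!: borel_measurable_sum borel_measurable_times borel_measurable_prod)

text \<open>On singular matrices \<^const>\<open>matrix_inv\<close> is \<open>SOME\<close> of the empty predicate, hence constant.\<close>

lemma matrix_inv_eq_cramer:
  fixes A :: "real^'a^'a"
  shows "matrix_inv A = (if det A = 0 then matrix_inv 0
     else (\<chi> k l. det (\<chi> i j. if j = k then axis l 1 $ i else A $ i $ j) / det A))"
proof (cases "det A = 0")
  case True
  then have "\<not> invertible A" and "\<not> invertible (0 :: real^'a^'a)"
    by (simp_all add: invertible_det_nz det_zero_row(1)[of undefined] row_def zero_vec_def)
  then have "(\<lambda>A'. A ** A' = mat 1 \<and> A' ** A = mat 1)
      = (\<lambda>A'. (0 :: real^'a^'a) ** A' = mat 1 \<and> A' ** (0 :: real^'a^'a) = mat 1)"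
    unfolding invertible_def by blast
  with True show ?thesis
    by (simp only: matrix_inv_def if_True simp_thms)
next
  case False
  have inv: "A ** matrix_inv A = mat 1"
    using False someI_ex[of "\<lambda>A'. A ** A' = mat 1 \<and> A' ** A = mat 1"]
    by (simp add: matrix_inv_def invertible_det_nz[symmetric] invertible_def)
  have "matrix_inv A $ k $ l = det (\<chi> i j. if j = k then axis l 1 $ i else A $ i $ j) / det A" for k l
  proof -
    have "A *v (matrix_inv A *v axis l 1) = axis l 1"
      by (simp add: matrix_vector_mul_assoc inv)
    then have "matrix_inv A *v axis l 1
        = (\<chi> k. det (\<chi> i j. if j = k then axis l 1 $ i else A $ i $ j) / det A)"
      using cramer[OF False] by blast
    moreover have "(matrix_inv A *v axis l 1) $ k = matrix_inv A $ k $ l"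
      by (simp add: matrix_vector_mult_basis column_def)
    ultimately show ?thesis by simp
  qed
  with False show ?thesis
    by (simp add: vec_eq_iff)
qed

lemma borel_measurable_matrix_inv:
  fixes X :: "'w \<Rightarrow> real^'a^'a"
  assumes X: "X \<in> borel_measurable N"
  shows "(\<lambda>\<omega>. matrix_inv (X \<omega>)) \<in> borel_measurable N"
proof -
  have entry: "(\<lambda>\<omega>. X \<omega> $ i $ j) \<in> borel_measurable N" for i j
    using X borel_measurable_matrix_iff by blast
  have "(\<lambda>\<omega>. \<chi> i j. if j = k then axis l 1 $ i else X \<omega> $ i $ j) \<in> borel_measurable N" for k l
    unfolding borel_measurable_matrix_iff using entry by simp
  note [measurable] = borel_measurable_det[OF this] borel_measurable_det[OF X]
  have cram: "(\<lambda>\<omega>. \<chi> k l. det (\<chi> i j. if j = k then axis l 1 $ i else X \<omega> $ i $ j) / det (X \<omega>)) \<in> borel_measurable N"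
    unfolding borel_measurable_matrix_iff by simp
  show ?thesis
    unfolding matrix_inv_eq_cramer[of "X _"] by (intro measurable_If cram) measurable
qed

text \<open>The Hessian may be discontinuous, but its entries are pointwise limits of difference
  quotients of the continuous gradient.\<close>

lemma borel_measurable_hessian:
  assumes F: "twice_differentiable F"
  shows "hessian F \<in> borel_measurable borel"
  unfolding borel_measurable_matrix_iff
proof (intro allI)
  fix i j :: 'a
  define G where "G u = gradient F u $ i" for u
  have "(\<lambda>u. vec_nth u i) \<in> borel_measurable borel"
    by (intro borel_measurable_continuous_onI continuous_intros)
  then have G: "G \<in> borel_measurable borel"
    unfolding G_def[abs_def] using borel_measurable_continuous_onI[OF continuous_on_gradient[OF F]]
    by (rule measurable_compose[rotated])
  define q where "q m x = (G (x + inverse (real (Suc m)) *\<^sub>R axis j 1) - G x) / inverse (real (Suc m))" for m x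
  have meas: "q m \<in> borel_measurable borel" for m
    unfolding q_def[abs_def] using G by (intro borel_measurable_divide borel_measurable_diff measurable_compose[OF _ G]) auto
  have lim: "(\<lambda>m. q m x) \<longlonglongrightarrow> hessian F x $ i $ j" for x
  proof -
    have "((\<lambda>t. x + t *\<^sub>R axis j 1) has_derivative (\<lambda>t. t *\<^sub>R axis j 1)) (at (0::real))"
      by (auto intro!: derivative_eq_intros)
    from diff_chain_at[OF this] has_derivative_gradient[OF F, of x]
    have "((\<lambda>t. gradient F (x + t *\<^sub>R axis j 1)) has_derivative (\<lambda>t. hessian F x *v (t *\<^sub>R axis j 1))) (at (0::real))"
      by (simp add: o_def)
    from bounded_linear.has_derivative[OF bounded_linear_vec_nth this, of i]
    have "((\<lambda>t. G (x + t *\<^sub>R axis j 1)) has_real_derivative hessian F x $ i $ j) (at 0)"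
      by (simp add: G_def has_field_derivative_def matrix_vector_mult_scaleR matrix_vector_mult_basis
          column_def mult.commute[of _ "_ $ _"])
    then have "((\<lambda>h. (G (x + h *\<^sub>R axis j 1) - G x) / h) \<longlongrightarrow> hessian F x $ i $ j) (at 0)"
      by (simp add: DERIV_def)
    moreover have "filterlim (\<lambda>m. inverse (real (Suc m))) (at 0) sequentially"
      unfolding filterlim_at using LIMSEQ_inverse_real_of_nat by simp
    ultimately show ?thesis
      unfolding q_def by (rule filterlim_compose)
  qed
  show "(\<lambda>x. hessian F x $ i $ j) \<in> borel_measurable borel"
    by (rule borel_measurable_LIMSEQ_real[OF lim meas])
qed

lemma borel_measurable_fst:
  "X \<in> borel_measurable N \<Longrightarrow> (\<lambda>\<omega>. fst (X \<omega>)) \<in> borel_measurable N"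
  by (rule measurable_compose[of X N borel fst]) (auto intro!: borel_measurable_continuous_onI continuous_intros)

lemma borel_measurable_snd:
  "X \<in> borel_measurable N \<Longrightarrow> (\<lambda>\<omega>. snd (X \<omega>)) \<in> borel_measurable N"
  by (rule measurable_compose[of X N borel snd]) (auto intro!: borel_measurable_continuous_onI continuous_intros)

lemma borel_measurable_bfgs_update:
  fixes X :: "'w \<Rightarrow> ('d::finite, 'q::finite) triple"
  assumes "X \<in> borel_measurable N" "H \<in> borel_measurable N"
  shows "(\<lambda>\<omega>. bfgs_update (X \<omega>) (H \<omega>)) \<in> borel_measurable N"
proof -
  have "bfgs_update t H = (mat 1 - fst t ** snd (snd t) ** transpose (fst (snd t))) ** H
      ** (mat 1 - fst (snd t) ** snd (snd t) ** transpose (fst t)) + fst t ** snd (snd t) ** transpose (fst t)"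
    for t :: "('d, 'q) triple" and H
    by (cases t) simp
  then show ?thesis
    using assms by (simp only:) (intro borel_measurable_add borel_measurable_diff borel_measurable_const
        borel_measurable_matrix_mult borel_measurable_transpose borel_measurable_fst borel_measurable_snd)
qed

lemma borel_measurable_metric_of:
  fixes L :: "('w \<Rightarrow> ('d::finite, 'q::finite) triple) list"
  assumes "set L \<subseteq> borel_measurable N"
  shows "(\<lambda>\<omega>. metric_of M (map (\<lambda>X. X \<omega>) L)) \<in> borel_measurable N"
proof -
  have "(\<lambda>\<omega>. foldr bfgs_update (map (\<lambda>X. X \<omega>) L') (mat 1)) \<in> borel_measurable N"
    if "set L' \<subseteq> borel_measurable N" for L'
    using that by (induction L') (auto intro: borel_measurable_bfgs_update)
  from this[of "take M L"] have "(\<lambda>\<omega>. foldr bfgs_update (map (\<lambda>X. X \<omega>) (take M L)) (mat 1)) \<in> borel_measurable N"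
    using assms set_take_subset[of M L] by blast
  then show ?thesis
    by (simp add: metric_of_def take_map)
qed

text \<open>Lists carry no \<open>\<sigma>\<close>-algebra in the library. The number of stored triples is deterministic,
  so a random memory is a fixed list of random triples.\<close>

definition random_state ::
  "'w measure \<Rightarrow> ('w \<Rightarrow> ('d::finite, 'q::finite) state) \<Rightarrow> bool" where
  "random_state N st \<longleftrightarrow> (\<lambda>\<omega>. fst (st \<omega>)) \<in> borel_measurable N \<and>
     (\<exists>L. set L \<subseteq> borel_measurable N \<and> (\<forall>\<omega>. snd (st \<omega>) = map (\<lambda>X. X \<omega>) L))"

context finite_sum_minimization
begin

text \<open>Batches range over a finite set, so measurability for each fixed batch suffices.
  \<open>N\<close> is arbitrary so that it can later be the \<open>\<sigma>\<close>-algebra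
  generated by past choices.\<close>

lemma random_state_inner_step:
  fixes st :: "'w \<Rightarrow> ('d, 'q::finite) state"
  assumes st: "random_state N st" and w: "w \<in> borel_measurable N"
    and A: "A \<in> N \<rightarrow>\<^sub>M count_space (batches n s)" and B: "B \<in> N \<rightarrow>\<^sub>M count_space (batches n s)"
    and D: "D \<in> borel_measurable N"
  shows "random_state N (\<lambda>\<omega>. inner_step f n \<eta> M (w \<omega>) (A \<omega>) (B \<omega>) (D \<omega>) (st \<omega>))"
proof -
  obtain L where L: "set L \<subseteq> borel_measurable N" "\<And>\<omega>. snd (st \<omega>) = map (\<lambda>X. X \<omega>) L"
    using st by (auto simp: random_state_def)
  have x: "(\<lambda>\<omega>. fst (st \<omega>)) \<in> borel_measurable N"
    using st by (simp add: random_state_def)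
  have count: "countable (batches n s)"
    using finite_batches by (rule countable_finite)
  have gm: "grad C \<in> borel_measurable borel" if "C \<subseteq> {1..n}" for C
    using that by (intro borel_measurable_continuous_onI continuous_on_gradient batch_twice_diff)
  have gA: "(\<lambda>\<omega>. grad (A \<omega>) (y \<omega>)) \<in> borel_measurable N" if "y \<in> borel_measurable N" for y
    by (rule measurable_compose_countable'[OF _ A count]) (rule measurable_compose[OF that gm[OF batchD(1)]])
  define Y where "Y \<omega> = hessian (batch_avg f (B \<omega>)) (fst (st \<omega>)) ** D \<omega>" for \<omega>
  have "(\<lambda>\<omega>. hessian (batch_avg f (B \<omega>)) (fst (st \<omega>))) \<in> borel_measurable N"
    by (rule measurable_compose_countable'[OF _ B count])
      (rule measurable_compose[OF x borel_measurable_hessian[OF batch_twice_diff[OF batchD(1)]]])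
  then have Y: "Y \<in> borel_measurable N"
    unfolding Y_def using D by (rule borel_measurable_matrix_mult)
  define X where "X \<omega> = (D \<omega>, Y \<omega>, matrix_inv (transpose (D \<omega>) ** Y \<omega>))" for \<omega>
  have X: "X \<in> borel_measurable N"
    unfolding X_def by (intro borel_measurable_Pair borel_measurable_matrix_inv borel_measurable_matrix_mult
        borel_measurable_transpose D Y)
  define g where "g \<omega> = grad (A \<omega>) (fst (st \<omega>)) - grad (A \<omega>) (w \<omega>) + grad {1..n} (w \<omega>)" for \<omega>
  have g: "g \<in> borel_measurable N"
    unfolding g_def using gA[OF x] gA[OF w] measurable_compose[OF w gm[OF full_batch(1)]]
    by (intro borel_measurable_add borel_measurable_diff)
  have "inner_step f n \<eta> M (w \<omega>) (A \<omega>) (B \<omega>) (D \<omega>) (st \<omega>)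
      = (fst (st \<omega>) - \<eta> *\<^sub>R (metric_of M (map (\<lambda>X. X \<omega>) (X # L)) *v g \<omega>), map (\<lambda>X. X \<omega>) (X # L))" for \<omega>
    by (cases "st \<omega>") (simp add: inner_step_def Let_def X_def Y_def g_def flip: L(2))
  moreover have XL: "set (X # L) \<subseteq> borel_measurable N"
    using X L by simp
  ultimately show ?thesis
    unfolding random_state_def
    using borel_measurable_matrix_vector_mult[OF borel_measurable_metric_of[OF XL] g] x
    by (auto simp del: list.map intro!: exI[of _ "X # L"])
qed

lemma random_state_inner_state:
  fixes st :: "'w \<Rightarrow> ('d, 'q::finite) state"
  assumes "random_state N st"
    and "\<And>t'. t' < t \<Longrightarrow> S t' \<in> N \<rightarrow>\<^sub>M count_space (batches n s)"
    and "\<And>t'. t' < t \<Longrightarrow> T t' \<in> N \<rightarrow>\<^sub>M count_space (batches n s)"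
    and "\<And>t'. t' < t \<Longrightarrow> D t' \<in> borel_measurable N"
  shows "random_state N (\<lambda>\<omega>. inner_state f n \<eta> M (st \<omega>) (\<lambda>t. S t \<omega>) (\<lambda>t. T t \<omega>) (\<lambda>t. D t \<omega>) t)"
  using assms(2-)
proof (induction t)
  case 0
  then show ?case using assms(1) by simp
next
  case (Suc t)
  then show ?case
    using assms(1) unfolding inner_state.simps
    by (intro random_state_inner_step) (auto simp: random_state_def)
qed

lemma random_state_outer_state:
  fixes D :: "nat \<Rightarrow> nat \<Rightarrow> 'w \<Rightarrow> real^'q^'d"
  assumes "\<And>k' t. k' < k \<Longrightarrow> t < m \<Longrightarrow> S k' t \<in> N \<rightarrow>\<^sub>M count_space (batches n s)"
    and "\<And>k' t. k' < k \<Longrightarrow> t < m \<Longrightarrow> T k' t \<in> N \<rightarrow>\<^sub>M count_space (batches n s)"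
    and "\<And>k' t. k' < k \<Longrightarrow> t < m \<Longrightarrow> D k' t \<in> borel_measurable N"
    and "\<And>k'. k' < k \<Longrightarrow> I k' \<in> N \<rightarrow>\<^sub>M count_space {1..m}"
  shows "random_state N (\<lambda>\<omega>. outer_state f n \<eta> m M w0 (\<lambda>k t. S k t \<omega>) (\<lambda>k t. T k t \<omega>)
           (\<lambda>k t. D k t \<omega>) (\<lambda>k. I k \<omega>) k)"
  using assms
proof (induction k)
  case 0
  then show ?case by (auto simp: random_state_def intro!: exI[of _ "[]"])
next
  case (Suc k)
  define inner where "inner t \<omega> = inner_state f n \<eta> M (outer_state f n \<eta> m M w0 (\<lambda>k t. S k t \<omega>)
      (\<lambda>k t. T k t \<omega>) (\<lambda>k t. D k t \<omega>) (\<lambda>k. I k \<omega>) k) (\<lambda>t. S k t \<omega>) (\<lambda>t. T k t \<omega>) (\<lambda>t. D k t \<omega>) t" for t \<omega>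
  have inner: "random_state N (inner t)" if "t \<le> m" for t
    unfolding inner_def using that Suc by (intro random_state_inner_state) auto
  \<comment> \<open>The random index is treated like the batches: first each fixed value, then
    composition over finitely many values.\<close>
  have "(\<lambda>\<omega>. fst (inner i \<omega>)) \<in> borel_measurable N" if "i \<in> {1..m}" for i
    using inner[of i] that by (simp add: random_state_def)
  moreover have "I k \<in> N \<rightarrow>\<^sub>M count_space {1..m}"
    using Suc.prems(4) by blast
  ultimately have "(\<lambda>\<omega>. fst (inner (I k \<omega>) \<omega>)) \<in> borel_measurable N"
    by (rule measurable_compose_countable') (auto intro: countable_finite)
  then show ?case
    using inner[of m] by (simp add: random_state_def Let_def inner_def)
qed

end

section \<open>Independence and expected decrease\<close>

lemma sigma_sets_vimage_subset:
  assumes "Z \<in> borel_measurable N"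
  shows "sigma_sets (space N) {Z -` A \<inter> space N | A. A \<in> sets borel} \<subseteq> sets N"
  using sets_image_in_sets[OF refl assms] by (simp add: sets_vimage_algebra)

lemma borel_measurable_from_vimage_algebra:
  assumes "Z \<in> borel_measurable (vimage_algebra (space M) X N)" "X \<in> M \<rightarrow>\<^sub>M N"
  shows "Z \<in> borel_measurable M"
  using assms(1) sets_image_in_sets[OF refl assms(2)] unfolding measurable_def by auto

text \<open>Real functions of \<open>X\<close> and of \<open>Y\<close> generate smaller
  \<open>\<sigma>\<close>-algebras, so independence passes to them in the form used by the product
  rule for expectations.\<close>

lemma (in prob_space) indep_rv_imp_indep_var:
  assumes XY: "indep_rv N X N' Y"
    and U: "U \<in> borel_measurable (vimage_algebra (space M) X N)"
    and V: "V \<in> borel_measurable (vimage_algebra (space M) Y N')"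
  shows "indep_var borel U borel V"
proof -
  have rv: "X \<in> M \<rightarrow>\<^sub>M N" "Y \<in> M \<rightarrow>\<^sub>M N'"
    and ind: "indep_set (sets (vimage_algebra (space M) X N)) (sets (vimage_algebra (space M) Y N'))"
    using XY by (auto simp: indep_rv_def)
  have "indep_set (sigma_sets (space M) {U -` A \<inter> space M | A. A \<in> sets borel})
      (sigma_sets (space M) {V -` A \<inter> space M | A. A \<in> sets borel})"
    unfolding indep_set_def
    by (rule indep_sets_mono_sets[OF ind[unfolded indep_set_def]])
      (use sigma_sets_vimage_subset[OF U] sigma_sets_vimage_subset[OF V] in \<open>auto split: bool.splits\<close>)
  then show ?thesis
    unfolding indep_var_eq
    using borel_measurable_from_vimage_algebra[OF U rv(1)] borel_measurable_from_vimage_algebra[OF V rv(2)]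
    by simp
qed

text \<open>A freezing argument: on the event \<open>X = a\<close> the integrand is
  \<open>Z a\<close>, and the indicator of that event is independent of \<open>Z a\<close>.
  Finiteness of \<open>A\<close> replaces conditional expectation by a finite sum.\<close>

lemma (in prob_space) uniform_indep_expectation:
  assumes X: "uniform_rv A X" "finite A" and XY: "indep_rv (count_space A) X N' Y"
    and Z: "\<And>a. a \<in> A \<Longrightarrow> Z a \<in> borel_measurable (vimage_algebra (space M) Y N')"
      "\<And>a. a \<in> A \<Longrightarrow> integrable M (Z a)"
  shows "integrable M (\<lambda>\<omega>. Z (X \<omega>) \<omega>)"
    and "expectation (\<lambda>\<omega>. Z (X \<omega>) \<omega>) = mean A (\<lambda>a. expectation (Z a))"
proof -
  define J where "J a \<omega> = indicat_real {a} (X \<omega>)" for a \<omega>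
  have Xm: "X \<in> M \<rightarrow>\<^sub>M count_space A" and dist: "distr M (count_space A) X = uniform_count_measure A"
    using X by (auto simp: uniform_rv_def)
  have XA: "X \<in> space M \<rightarrow> A"
    using measurable_space[OF Xm] by auto
  have prob: "prob {\<omega> \<in> space M. X \<omega> = a} = 1 / card A" if "a \<in> A" for a
  proof -
    have "prob (X -` {a} \<inter> space M) = measure (uniform_count_measure A) {a}"
      unfolding dist[symmetric] using that by (intro measure_distr[symmetric] Xm) auto
    also have "\<dots> = 1 / card A"
      using that \<open>finite A\<close> by (simp add: measure_uniform_count_measure)
    also have "X -` {a} \<inter> space M = {\<omega> \<in> space M. X \<omega> = a}"
      by auto
    finally show ?thesis .
  qed
  have Jm: "J a \<in> borel_measurable (vimage_algebra (space M) X (count_space A))" for a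
    unfolding J_def using XA
    by (intro measurable_compose[OF measurable_vimage_algebra1]) auto
  have Jeq: "J a \<omega> = indicator {\<omega> \<in> space M. X \<omega> = a} \<omega>" if "\<omega> \<in> space M" for a \<omega>
    using that by (auto simp: J_def indicator_def)
  have set: "{\<omega> \<in> space M. X \<omega> = a} \<in> events" if "a \<in> A" for a
    using measurable_sets[OF Xm, of "{a}"] that by (auto simp: vimage_def Int_def conj_commute)
  have J: "integrable M (J a)" "expectation (J a) = 1 / card A" if "a \<in> A" for a
    using set[OF that] prob[OF that] Jeq[of _ a] emeasure_finite
    by (simp_all add: less_top[symmetric] integrable_indicator_iff
        cong: Bochner_Integration.integrable_cong Bochner_Integration.integral_cong)
  note ind = indep_rv_imp_indep_var[OF XY Jm Z(1)]
  have int: "integrable M (\<lambda>\<omega>. J a \<omega> * Z a \<omega>)"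
    and exp: "expectation (\<lambda>\<omega>. J a \<omega> * Z a \<omega>) = expectation (Z a) / card A" if "a \<in> A" for a
    using indep_var_integrable[OF ind J(1) Z(2), of a a] indep_var_lebesgue_integral[OF ind J(1) Z(2), of a a] J(2) that
    by auto
  have eq: "Z (X \<omega>) \<omega> = (\<Sum>a\<in>A. J a \<omega> * Z a \<omega>)" if "\<omega> \<in> space M" for \<omega>
  proof -
    have "(\<Sum>a\<in>A. J a \<omega> * Z a \<omega>) = (\<Sum>a\<in>A. if a = X \<omega> then Z a \<omega> else 0)"
      by (intro sum.cong) (auto simp: J_def)
    then show ?thesis
      using XA that \<open>finite A\<close> by auto
  qed
  show "integrable M (\<lambda>\<omega>. Z (X \<omega>) \<omega>)"
    by (subst Bochner_Integration.integrable_cong[OF refl eq]) (auto intro: int)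
  have "expectation (\<lambda>\<omega>. Z (X \<omega>) \<omega>) = (\<Sum>a\<in>A. expectation (\<lambda>\<omega>. J a \<omega> * Z a \<omega>))"
    by (subst Bochner_Integration.integral_cong[OF refl eq]) (auto intro: int Bochner_Integration.integral_sum)
  then show "expectation (\<lambda>\<omega>. Z (X \<omega>) \<omega>) = mean A (\<lambda>a. expectation (Z a))"
    by (simp add: exp mean_def sum_divide_distrib)
qed

text \<open>With \<open>N\<close> generated by the history, this makes each earlier choice
  measurable with respect to the past.\<close>

lemma measurable_history_components:
  assumes h: "history S T D I m k t \<in> N \<rightarrow>\<^sub>M history_space n s m k t"
  shows "(k', t') \<in> earlier_steps m k t \<Longrightarrow> S k' t' \<in> N \<rightarrow>\<^sub>M count_space (batches n s)"
    and "(k', t') \<in> earlier_steps m k t \<Longrightarrow> T k' t' \<in> N \<rightarrow>\<^sub>M count_space (batches n s)"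
    and "(k', t') \<in> earlier_steps m k t \<Longrightarrow> D k' t' \<in> borel_measurable N"
    and "k' < k \<Longrightarrow> I k' \<in> N \<rightarrow>\<^sub>M count_space {1..m}"
proof -
  have fst: "(\<lambda>\<omega>. fst (history S T D I m k t \<omega>)) \<in> N \<rightarrow>\<^sub>M PiM (earlier_steps m k t)
      (\<lambda>_. count_space (batches n s) \<Otimes>\<^sub>M count_space (batches n s) \<Otimes>\<^sub>M borel)"
    and snd: "(\<lambda>\<omega>. snd (history S T D I m k t \<omega>)) \<in> N \<rightarrow>\<^sub>M PiM {..<k} (\<lambda>_. count_space {1..m})"
    using h unfolding history_space_def
    by (auto intro: measurable_compose[OF _ measurable_fst] measurable_compose[OF _ measurable_snd])
  show "I k' \<in> N \<rightarrow>\<^sub>M count_space {1..m}" if "k' < k"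
    using measurable_compose[OF snd measurable_component_singleton[of k']] that by (simp add: history_def)
  assume e: "(k', t') \<in> earlier_steps m k t"
  have c: "(\<lambda>\<omega>. (S k' t' \<omega>, T k' t' \<omega>, D k' t' \<omega>)) \<in> N \<rightarrow>\<^sub>M count_space (batches n s) \<Otimes>\<^sub>M count_space (batches n s) \<Otimes>\<^sub>M borel"
    using measurable_compose[OF fst measurable_component_singleton[OF e]] e by (simp add: history_def)
  show "S k' t' \<in> N \<rightarrow>\<^sub>M count_space (batches n s)"
    using measurable_compose[OF c measurable_fst] by simp
  note c2 = measurable_compose[OF c measurable_snd]
  show "T k' t' \<in> N \<rightarrow>\<^sub>M count_space (batches n s)" "D k' t' \<in> borel_measurable N"
    using measurable_compose[OF c2 measurable_fst] measurable_compose[OF c2 measurable_snd] by simp_all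
qed


section \<open>Expected gaps along the random iterates\<close>

locale stochastic_block_bfgs =
  finite_sum_minimization f n s lam Lam wstar + random_choices P n s m S T D I
  for f :: "nat \<Rightarrow> real^'d \<Rightarrow> real" and n s lam Lam wstar and P :: "'w measure" and m S T
    and D :: "nat \<Rightarrow> nat \<Rightarrow> 'w \<Rightarrow> real^'q^'d" and I +
  fixes M :: nat and \<eta> \<gamma> \<Gamma> :: real and w0 :: "real^'d"
  assumes gamma_pos: "0 < \<gamma>" and gamma_le: "\<gamma> \<le> \<Gamma>" and eta_pos: "0 < \<eta>"
    and metric_bounds: "t < m \<Longrightarrow>
      AE \<omega> in P. \<gamma> *\<^sub>R mat 1 \<preceq> metric_matrix f n \<eta> m M w0 (\<lambda>k t. S k t \<omega>) (\<lambda>k t. T k t \<omega>)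
                    (\<lambda>k t. D k t \<omega>) (\<lambda>k. I k \<omega>) k t \<and>
                metric_matrix f n \<eta> m M w0 (\<lambda>k t. S k t \<omega>) (\<lambda>k t. T k t \<omega>)
                    (\<lambda>k t. D k t \<omega>) (\<lambda>k. I k \<omega>) k t \<preceq> \<Gamma> *\<^sub>R mat 1"
begin

definition outer where
  "outer k \<omega> = outer_state f n \<eta> m M w0 (\<lambda>k t. S k t \<omega>) (\<lambda>k t. T k t \<omega>) (\<lambda>k t. D k t \<omega>) (\<lambda>k. I k \<omega>) k"

definition inner where
  "inner k t \<omega> = inner_state f n \<eta> M (outer k \<omega>) (\<lambda>t. S k t \<omega>) (\<lambda>t. T k t \<omega>) (\<lambda>t. D k t \<omega>) t"

definition inner_gap where
  "inner_gap k t \<omega> = gap (fst (inner k t \<omega>))"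

text \<open>The constant \<open>c\<close> of the proof idea; \<open>noise\<close> is its
  \<open>b\<close>.\<close>

definition decrease where
  "decrease = 2 * \<eta> * (\<gamma> * lam - \<eta> * \<Gamma>\<^sup>2 * Lam\<^sup>2)"

definition noise where
  "noise = 2 * \<eta>\<^sup>2 * \<Gamma>\<^sup>2 * Lam * (Lam - lam)"

lemma inner_0: "inner k 0 \<omega> = outer k \<omega>"
  by (simp add: inner_def)

lemma inner_Suc:
  "inner k (Suc t) \<omega> = inner_step f n \<eta> M (fst (outer k \<omega>)) (S k t \<omega>) (T k t \<omega>) (D k t \<omega>) (inner k t \<omega>)"
  by (simp add: inner_def)

lemma fst_outer_Suc: "fst (outer (Suc k) \<omega>) = fst (inner k (I k \<omega>) \<omega>)"
  by (simp add: outer_def inner_def Let_def)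

lemma metric_matrix_eq:
  "metric_matrix f n \<eta> m M w0 (\<lambda>k t. S k t \<omega>) (\<lambda>k t. T k t \<omega>) (\<lambda>k t. D k t \<omega>) (\<lambda>k. I k \<omega>) k t
     = metric_of M (snd (inner k (Suc t) \<omega>))"
  by (simp only: metric_matrix_def inner_def outer_def)

text \<open>The new triple depends only on the current iterate, the Hessian batch and the sketch.
  Hence freezing the gradient batch does not change the metric.\<close>

lemma snd_inner_step: "snd (inner_step f n \<eta> M w A B C st) = snd (inner_step f n \<eta> M w A' B C st)"
  by (cases st) (simp add: inner_step_def Let_def)

lemma fst_inner_step:
  "fst (inner_step f n \<eta> M w A B C st) = fst st - \<eta> *\<^sub>R (metric_of M (snd (inner_step f n \<eta> M w A B C st))
     *v (grad A (fst st) - grad A w + grad {1..n} w))"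
  by (cases st) (simp add: inner_step_def Let_def)

lemma random_state_inner:
  assumes h: "history S T D I m k t \<in> N \<rightarrow>\<^sub>M history_space n s m k t" and "t \<le> m"
  shows "random_state N (inner k t)" and "random_state N (outer k)"
proof -
  note c = measurable_history_components[OF h]
  show *: "random_state N (outer k)"
    unfolding outer_def using c by (intro random_state_outer_state) (auto simp: earlier_steps_def)
  show "random_state N (inner k t)"
    unfolding inner_def using c \<open>t \<le> m\<close>
    by (intro random_state_inner_state *) (auto simp: earlier_steps_def)
qed

lemma borel_measurable_gap:
  assumes "random_state N st"
  shows "(\<lambda>\<omega>. gap (fst (st \<omega>))) \<in> borel_measurable N"
proof -
  have "F \<in> borel_measurable borel"
    by (intro borel_measurable_continuous_onI continuous_on_twice_differentiable batch_twice_diff) simp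
  with assms show ?thesis
    unfolding gap_def random_state_def by (auto intro: measurable_compose)
qed

text \<open>\<open>S k t\<close> is independent of the past together with \<open>T k t\<close> and
  \<open>D k t\<close>, hence of the metric. Freezing it reduces the claim to
  \<open>mean_gap_step\<close>, which is then integrated.\<close>

lemma expected_inner_gap_step:
  assumes "t < m" "decrease \<le> 1" "integrable P (inner_gap k 0)" "integrable P (inner_gap k t)"
  shows "integrable P (inner_gap k (Suc t))"
    and "expectation (inner_gap k (Suc t))
      \<le> (1 - decrease) * expectation (inner_gap k t) + noise * expectation (inner_gap k 0)"
proof -
  let ?Y = "\<lambda>\<omega>. (history S T D I m k t \<omega>, T k t \<omega>, D k t \<omega>)"
  let ?K = "history_space n s m k t \<Otimes>\<^sub>M count_space (batches n s) \<Otimes>\<^sub>M (borel :: (real^'q^'d) measure)"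
  let ?N = "vimage_algebra (space P) ?Y ?K"
  \<comment> \<open>The gap after a step whose gradient batch is frozen at \<open>A\<close>, while
    the iterate, Hessian batch and sketch stay random.\<close>
  define Z where "Z A \<omega> = gap (fst (inner_step f n \<eta> M (fst (outer k \<omega>)) A (T k t \<omega>) (D k t \<omega>) (inner k t \<omega>)))" for A \<omega>
  define bound where "bound \<omega> = (1 - decrease) * inner_gap k t \<omega> + noise * inner_gap k 0 \<omega>" for \<omega>
  note indep = S_indep[OF \<open>t < m\<close>, of k]
  then have rv: "?Y \<in> P \<rightarrow>\<^sub>M ?K"
    by (simp add: indep_rv_def)
  then have Y: "?Y \<in> ?N \<rightarrow>\<^sub>M ?K"
    by (intro measurable_vimage_algebra1) (auto dest: measurable_space)
  have h: "history S T D I m k t \<in> ?N \<rightarrow>\<^sub>M history_space n s m k t"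
    using measurable_compose[OF Y measurable_fst] by simp
  note TD = measurable_compose[OF Y measurable_snd]
  have T: "T k t \<in> ?N \<rightarrow>\<^sub>M count_space (batches n s)" and D: "D k t \<in> borel_measurable ?N"
    using measurable_compose[OF TD measurable_fst] measurable_compose[OF TD measurable_snd] by simp_all
  have Zm: "Z A \<in> borel_measurable ?N" if "A \<in> batches n s" for A
    unfolding Z_def using random_state_inner[OF h] \<open>t < m\<close> that T D
    by (intro borel_measurable_gap random_state_inner_step) (auto simp: random_state_def)
  have Z_nonneg: "0 \<le> Z A \<omega>" for A \<omega>
    by (simp add: Z_def gap_nonneg)
  have mean_le: "AE \<omega> in P. mean (batches n s) (\<lambda>A. Z A \<omega>) \<le> bound \<omega>"
    using metric_bounds[OF \<open>t < m\<close>, of k]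
  proof eventually_elim
    case (elim \<omega>)
    have "Z A \<omega> = gap (fst (inner k t \<omega>) - \<eta> *\<^sub>R (metric_of M (snd (inner k (Suc t) \<omega>))
        *v (grad A (fst (inner k t \<omega>)) - grad A (fst (outer k \<omega>)) + grad {1..n} (fst (outer k \<omega>)))))" for A
      unfolding Z_def inner_Suc by (subst fst_inner_step) (simp only: snd_inner_step[of _ A _ _ _ "S k t \<omega>"])
    then show ?case
      using mean_gap_step[of \<gamma> "metric_of M (snd (inner k (Suc t) \<omega>))" \<Gamma> \<eta> "fst (inner k t \<omega>)" "fst (outer k \<omega>)"]
        elim gamma_pos eta_pos
      by (simp add: metric_matrix_eq bound_def inner_gap_def inner_0 decrease_def noise_def del: One_nat_def)
  qed
  have bound_int: "integrable P bound"
    unfolding bound_def using assms by simp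
  \<comment> \<open>Only the mean over batches is bounded; nonnegativity of the gap lets the number
    of batches times \<open>bound\<close> dominate each summand.\<close>
  have Z_int: "integrable P (Z A)" if "A \<in> batches n s" for A
  proof (rule Bochner_Integration.integrable_bound[of P "\<lambda>\<omega>. real (card (batches n s)) * bound \<omega>"])
    show "Z A \<in> borel_measurable P"
      using Zm[OF that] rv by (rule borel_measurable_from_vimage_algebra)
    show "AE \<omega> in P. norm (Z A \<omega>) \<le> norm (real (card (batches n s)) * bound \<omega>)"
      using mean_le
    proof eventually_elim
      case (elim \<omega>)
      have "Z A \<omega> \<le> real (card (batches n s)) * mean (batches n s) (\<lambda>A. Z A \<omega>)"
        using le_mean[OF finite_batches that, of "\<lambda>A. Z A \<omega>"] Z_nonneg by blast
      also have "\<dots> \<le> real (card (batches n s)) * bound \<omega>"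
        using elim by (intro mult_left_mono) auto
      finally show ?case using Z_nonneg[of A \<omega>] by simp
    qed
  qed (use bound_int in simp)
  have eq: "inner_gap k (Suc t) = (\<lambda>\<omega>. Z (S k t \<omega>) \<omega>)"
    by (simp add: inner_gap_def[abs_def] Z_def inner_Suc)
  note E = uniform_indep_expectation[where Z = Z, OF S_uniform[OF \<open>t < m\<close>] finite_batches indep Zm Z_int]
  show "integrable P (inner_gap k (Suc t))"
    unfolding eq by (rule E)
  have "expectation (inner_gap k (Suc t)) = expectation (\<lambda>\<omega>. mean (batches n s) (\<lambda>A. Z A \<omega>))"
    unfolding eq using E(2) Z_int by (simp add: mean_def)
  also have "\<dots> \<le> expectation bound"
    using mean_le bound_int Z_int unfolding mean_def by (intro integral_mono_AE) auto
  also have "\<dots> = (1 - decrease) * expectation (inner_gap k t) + noise * expectation (inner_gap k 0)"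
    unfolding bound_def using assms by simp
  finally show "expectation (inner_gap k (Suc t)) \<le> \<dots>" .
qed

text \<open>\<open>I k\<close> is independent of the entire inner loop, so freezing it at each value
  gives the plain average of the expected inner gaps.\<close>

lemma expected_outer_gap:
  assumes int: "\<And>t. t \<le> m \<Longrightarrow> integrable P (inner_gap k t)"
  shows "integrable P (inner_gap (Suc k) 0)"
    and "expectation (inner_gap (Suc k) 0) = mean {1..m} (\<lambda>t. expectation (inner_gap k t))"
proof -
  let ?Y = "history S T D I m k m" and ?K = "history_space n s m k m"
  let ?N = "vimage_algebra (space P) ?Y ?K"
  have "?Y \<in> P \<rightarrow>\<^sub>M ?K"
    using I_indep[of k] by (simp add: indep_rv_def)
  then have Y: "?Y \<in> ?N \<rightarrow>\<^sub>M ?K"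
    by (intro measurable_vimage_algebra1) (auto dest: measurable_space)
  note c = measurable_history_components[OF Y]
  have inner: "random_state ?N (inner k t)" if "t \<le> m" for t
    unfolding inner_def using c that
    by (intro random_state_inner_state random_state_inner[OF Y order_refl]) (auto simp: earlier_steps_def)
  have meas: "inner_gap k t \<in> borel_measurable ?N" if "t \<in> {1..m}" for t
    using borel_measurable_gap[OF inner] that by (simp add: inner_gap_def[abs_def])
  have eq: "inner_gap (Suc k) 0 = (\<lambda>\<omega>. inner_gap k (I k \<omega>) \<omega>)"
    by (simp add: inner_gap_def[abs_def] inner_0 fst_outer_Suc)
  note E = uniform_indep_expectation[where Z = "inner_gap k", OF I_uniform finite_atLeastAtMost I_indep meas int]
  show "integrable P (inner_gap (Suc k) 0)"
    unfolding eq by (rule E) auto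
  show "expectation (inner_gap (Suc k) 0) = mean {1..m} (\<lambda>t. expectation (inner_gap k t))"
    unfolding eq by (rule E) auto
qed

lemma integrable_inner_gap:
  assumes "decrease \<le> 1" "integrable P (inner_gap k 0)" "t \<le> m"
  shows "integrable P (inner_gap k t)"
  using assms(3) by (induction t) (auto intro: assms expected_inner_gap_step)

text \<open>Adding the one-step inequalities telescopes. The last gap is kept on the left to pay for
  the later index shift.\<close>

lemma sum_expected_inner_gap:
  assumes "decrease \<le> 1" "integrable P (inner_gap k 0)" "t \<le> m"
  shows "decrease * (\<Sum>i<t. expectation (inner_gap k i)) + expectation (inner_gap k t)
    \<le> (1 + real t * noise) * expectation (inner_gap k 0)"
  using assms(3)
proof (induction t)
  case 0
  then show ?case by simp
next
  case (Suc t)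
  then have "expectation (inner_gap k (Suc t))
      \<le> (1 - decrease) * expectation (inner_gap k t) + noise * expectation (inner_gap k 0)"
    by (intro expected_inner_gap_step assms integrable_inner_gap) auto
  with Suc show ?case by (simp add: algebra_simps)
qed

lemma expected_gap_contraction:
  assumes d: "0 < decrease" "decrease \<le> 1" and m: "0 < m" and int: "integrable P (inner_gap k 0)"
  shows "integrable P (inner_gap (Suc k) 0)"
    and "expectation (inner_gap (Suc k) 0)
      \<le> (1 + real m * noise) / (real m * decrease) * expectation (inner_gap k 0)"
proof -
  let ?e = "\<lambda>t. expectation (inner_gap k t)"
  note i = integrable_inner_gap[OF d(2) int]
  show "integrable P (inner_gap (Suc k) 0)"
    by (rule expected_outer_gap) (rule i)
  have nonneg: "0 \<le> ?e t" for t
    by (simp add: inner_gap_def gap_nonneg)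
  \<comment> \<open>The telescoped sum covers steps 0 to \<open>m - 1\<close>, whereas the output is
    drawn from steps 1 to \<open>m\<close>.\<close>
  have "(\<Sum>t\<in>{1..l}. h t) = (\<Sum>t<l. h t) + h l - h 0" for h :: "nat \<Rightarrow> real" and l
    by (induction l) auto
  from this[of ?e m] have "decrease * (\<Sum>t\<in>{1..m}. ?e t) = decrease * (\<Sum>t<m. ?e t) + decrease * ?e m - decrease * ?e 0"
    by (simp only: distrib_left right_diff_distrib)
  \<comment> \<open>Here \<open>decrease \<le> 1\<close> absorbs \<open>decrease * ?e m\<close> into
    \<open>?e m\<close>, and the initial term is dropped by nonnegativity.\<close>
  also have "\<dots> \<le> decrease * (\<Sum>t<m. ?e t) + ?e m"
    using d nonneg[of 0] nonneg[of m] by (smt (verit) mult_left_le_one_le mult_nonneg_nonneg)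
  also have "\<dots> \<le> (1 + real m * noise) * ?e 0"
    by (rule sum_expected_inner_gap) (use d int in auto)
  finally have "(\<Sum>t\<in>{1..m}. ?e t) \<le> (1 + real m * noise) * ?e 0 / decrease"
    using d by (simp add: field_simps)
  from divide_right_mono[OF this, of "real m"]
  have "mean {1..m} ?e \<le> (1 + real m * noise) * ?e 0 / decrease / real m"
    by (simp add: mean_def)
  then show "expectation (inner_gap (Suc k) 0)
      \<le> (1 + real m * noise) / (real m * decrease) * expectation (inner_gap k 0)"
    using expected_outer_gap(2)[OF i] by (simp add: mult.commute)
qed

lemma expected_gap_linear_rate:
  assumes d: "0 < decrease" "decrease \<le> 1" and m: "0 < m" and noise: "0 \<le> noise"
  shows "integrable P (inner_gap k 0) \<and>
    expectation (inner_gap k 0) \<le> ((1 + real m * noise) / (real m * decrease)) ^ k * expectation (inner_gap 0 0)"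
proof (induction k)
  case 0
  \<comment> \<open>The starting point is deterministic, so integrability at \<open>k = 0\<close> is
    immediate and propagates from there.\<close>
  have "inner_gap 0 0 = (\<lambda>_. gap w0)"
    by (simp add: inner_gap_def[abs_def] inner_0 outer_def)
  then show ?case by simp
next
  case (Suc k)
  let ?r = "(1 + real m * noise) / (real m * decrease)"
  have "0 \<le> ?r" using d noise by simp
  have "expectation (inner_gap (Suc k) 0) \<le> ?r * expectation (inner_gap k 0)"
    using expected_gap_contraction(2)[OF d m] Suc by blast
  also have "\<dots> \<le> ?r * (?r ^ k * expectation (inner_gap 0 0))"
    using Suc \<open>0 \<le> ?r\<close> by (intro mult_left_mono) auto
  finally show ?case
    using expected_gap_contraction(1)[OF d m] Suc by (simp add: mult.assoc)
qed

end

text \<open>At \<open>m = m_min\<close> the rate equals 1 exactly, hence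
  \<open>\<rho> \<le> 1\<close> in general and strictness for \<open>m_min < m\<close>.
  Integrability is part of the conclusion because the integral of a non-integrable function is 0 by
  convention.\<close>

theorem theorem1:
  fixes f :: "nat \<Rightarrow> real^'d \<Rightarrow> real"
    and n s m M :: nat
    and \<eta> lam Lam \<gamma> \<Gamma> :: real
    and w0 wstar :: "real^'d"
    and P :: "'w measure"
    and S T :: "nat \<Rightarrow> nat \<Rightarrow> 'w \<Rightarrow> nat set"
    and D :: "nat \<Rightarrow> nat \<Rightarrow> 'w \<Rightarrow> real^'q^'d"
    and I :: "nat \<Rightarrow> 'w \<Rightarrow> nat"
  defines "F \<equiv> batch_avg f {1..n}"
    and "w \<equiv> (\<lambda>k \<omega>. outer_iterate f n \<eta> m M w0 (\<lambda>k t. S k t \<omega>) (\<lambda>k t. T k t \<omega>)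
                        (\<lambda>k t. D k t \<omega>) (\<lambda>k. I k \<omega>) k)"
    and "H \<equiv> (\<lambda>k t \<omega>. metric_matrix f n \<eta> m M w0 (\<lambda>k t. S k t \<omega>) (\<lambda>k t. T k t \<omega>)
                        (\<lambda>k t. D k t \<omega>) (\<lambda>k. I k \<omega>) k t)"
    and "m_min \<equiv> 1 / (2 * \<eta> * (\<gamma> * lam - \<eta> * \<Gamma>\<^sup>2 * Lam * (2 * Lam - lam)))"
    and "\<rho> \<equiv> (1 / (2 * real m * \<eta>) + \<eta> * \<Gamma>\<^sup>2 * Lam * (Lam - lam))
                 / (\<gamma> * lam - \<eta> * \<Gamma>\<^sup>2 * Lam\<^sup>2)"
  assumes "1 \<le> s" and "s \<le> n" and "1 \<le> M"
    and "\<And>i. i \<in> {1..n} \<Longrightarrow> convex_on UNIV (f i)"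
    and "\<And>i. i \<in> {1..n} \<Longrightarrow> twice_differentiable (f i)"
    and "0 < lam" and "lam \<le> Lam"
    and "\<And>A x. A \<subseteq> {1..n} \<Longrightarrow> A \<noteq> {} \<Longrightarrow>
           lam *\<^sub>R mat 1 \<preceq> hessian (batch_avg f A) x \<and>
           hessian (batch_avg f A) x \<preceq> Lam *\<^sub>R mat 1"
    and "is_arg_min F (\<lambda>_. True) wstar"
    and "random_choices P n s m S T D I"
    and "0 < \<gamma>" and "\<gamma> \<le> \<Gamma>"
    and "\<And>k t. t < m \<Longrightarrow>
           AE \<omega> in P. \<gamma> *\<^sub>R mat 1 \<preceq> H k t \<omega> \<and> H k t \<omega> \<preceq> \<Gamma> *\<^sub>R mat 1"
    and "0 < \<eta>" and "\<eta> < \<gamma> * lam / (2 * \<Gamma>\<^sup>2 * Lam\<^sup>2)"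
    and "m_min \<le> real m"
  shows "(\<forall>k. integrable P (\<lambda>\<omega>. F (w k \<omega>) - F wstar) \<and>
              (\<integral>\<omega>. F (w k \<omega>) - F wstar \<partial>P) \<le> \<rho> ^ k * (\<integral>\<omega>. F (w 0 \<omega>) - F wstar \<partial>P))
       \<and> \<rho> \<le> 1 \<and> (m_min < real m \<longrightarrow> \<rho> < 1)"
proof -
  interpret random_choices P n s m S T D I by fact
  interpret stochastic_block_bfgs f n s lam Lam wstar P m S T D I M \<eta> \<gamma> \<Gamma> w0
    using assms(6-18) \<open>0 < \<eta>\<close> unfolding F_def H_def by unfold_locales auto
  \<comment> \<open>In these terms \<open>\<rho>\<close> is
    \<open>(1 / (2 * m * \<eta>) + X) / Y\<close> and \<open>m_min\<close> is
    \<open>1 / (2 * \<eta> * (Y - X))\<close>; so comparing \<open>\<rho>\<close> with 1 amounts to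
    comparing \<open>m_min\<close> with \<open>m\<close>.\<close>
  define X Y where "X = \<eta> * \<Gamma>\<^sup>2 * Lam * (Lam - lam)" and "Y = \<gamma> * lam - \<eta> * \<Gamma>\<^sup>2 * Lam\<^sup>2"
  have pos: "0 < \<Gamma>" "0 < \<Gamma>\<^sup>2 * Lam\<^sup>2" "0 < \<gamma> * lam"
    using gamma_pos gamma_le lam_pos Lam_pos by auto
  have "0 \<le> X"
    unfolding X_def using eta_pos Lam_pos lam_le_Lam by simp
  have eta: "2 * (\<eta> * (\<Gamma>\<^sup>2 * Lam\<^sup>2)) < \<gamma> * lam"
    using \<open>\<eta> < \<gamma> * lam / (2 * \<Gamma>\<^sup>2 * Lam\<^sup>2)\<close> pos by (simp add: field_simps)
  have "Y - X = \<gamma> * lam - 2 * (\<eta> * (\<Gamma>\<^sup>2 * Lam\<^sup>2)) + \<eta> * \<Gamma>\<^sup>2 * Lam * lam"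
    by (simp add: X_def Y_def algebra_simps power2_eq_square)
  moreover have "0 \<le> \<eta> * \<Gamma>\<^sup>2 * Lam * lam"
    using eta_pos Lam_pos lam_pos by simp
  ultimately have "0 < Y - X"
    using eta by linarith
  have "m_min = 1 / (2 * \<eta> * (Y - X))"
    unfolding m_min_def X_def Y_def by (simp add: algebra_simps power2_eq_square)
  moreover have "0 < 2 * \<eta> * (Y - X)"
    using eta_pos \<open>0 < Y - X\<close> by simp
  ultimately have m_min: "0 < m_min" "m_min * (2 * \<eta> * (Y - X)) = 1"
    by auto
  then have m: "0 < m"
    using \<open>m_min \<le> real m\<close> by linarith
  have rho: "\<rho> = (1 / (2 * real m * \<eta>) + X) / Y"
    by (simp add: \<rho>_def X_def Y_def)
  have Y: "0 < Y"
    using \<open>0 \<le> X\<close> \<open>0 < Y - X\<close> by linarith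
  \<comment> \<open>Numerator and denominator are multiplied by
    \<open>2 * m * \<eta>\<close>.\<close>
  have rate: "\<rho> = (1 + real m * noise) / (real m * decrease)"
  proof -
    have "noise = 2 * \<eta> * X" "decrease = 2 * \<eta> * Y"
      by (simp_all add: noise_def decrease_def X_def Y_def power2_eq_square)
    then show ?thesis
      unfolding rho using m eta_pos Y by (simp add: field_simps)
  qed
  have d_pos: "0 < decrease"
    using eta_pos Y by (simp add: decrease_def Y_def)
  \<comment> \<open>The stepsize bound is multiplied by \<open>\<gamma> * lam\<close>; then
    \<open>\<gamma> * lam \<le> \<Gamma> * Lam\<close> allows the squared product of
    \<open>\<Gamma>\<close> and \<open>Lam\<close> to be cancelled.\<close>
  have d_le: "decrease \<le> 1"
  proof -
    have "\<gamma> * lam \<le> \<Gamma> * Lam"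
      using gamma_pos gamma_le lam_pos lam_le_Lam by (intro mult_mono) auto
    then have "(\<gamma> * lam) * (\<gamma> * lam) \<le> (\<Gamma> * Lam) * (\<Gamma> * Lam)"
      using pos Lam_pos by (intro mult_mono[of "\<gamma> * lam" "\<Gamma> * Lam" "\<gamma> * lam"]) simp_all
    moreover have "2 * (\<eta> * (\<Gamma>\<^sup>2 * Lam\<^sup>2)) * (\<gamma> * lam) \<le> (\<gamma> * lam) * (\<gamma> * lam)"
      using eta pos by (intro mult_right_mono) auto
    ultimately have "(2 * \<eta> * (\<gamma> * lam)) * (\<Gamma>\<^sup>2 * Lam\<^sup>2) \<le> 1 * (\<Gamma>\<^sup>2 * Lam\<^sup>2)"
      by (simp add: power2_eq_square algebra_simps)
    then have "2 * \<eta> * (\<gamma> * lam) \<le> 1"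
      using pos(2) mult_le_cancel_right_pos by blast
    moreover have "decrease \<le> 2 * \<eta> * (\<gamma> * lam)"
      using eta_pos pos by (simp add: decrease_def)
    ultimately show ?thesis by linarith
  qed
  have noise: "0 \<le> noise"
    using Lam_pos lam_le_Lam by (simp add: noise_def)
  have gap: "F (w k \<omega>) - F wstar = inner_gap k 0 \<omega>" for k \<omega>
    by (simp add: F_def w_def inner_gap_def gap_def inner_0 outer_def outer_iterate_def)
  have conv: "\<forall>k. integrable P (\<lambda>\<omega>. F (w k \<omega>) - F wstar) \<and>
      (\<integral>\<omega>. F (w k \<omega>) - F wstar \<partial>P) \<le> \<rho> ^ k * (\<integral>\<omega>. F (w 0 \<omega>) - F wstar \<partial>P)"
    unfolding gap rate using expected_gap_linear_rate[OF d_pos d_le m noise] by simp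
  have "\<rho> \<le> 1 \<longleftrightarrow> m_min \<le> real m" "\<rho> < 1 \<longleftrightarrow> m_min < real m"
  proof -
    have "1 / (2 * real m * \<eta>) = m_min * (Y - X) / real m"
      using m_min(2) m eta_pos by (simp add: field_simps)
    then have "\<rho> \<le> 1 \<longleftrightarrow> m_min * (Y - X) / real m \<le> Y - X" "\<rho> < 1 \<longleftrightarrow> m_min * (Y - X) / real m < Y - X"
      using Y by (simp_all only: rho pos_divide_le_eq pos_divide_less_eq le_diff_eq less_diff_eq mult_1)
    then show "\<rho> \<le> 1 \<longleftrightarrow> m_min \<le> real m" "\<rho> < 1 \<longleftrightarrow> m_min < real m"
      using m \<open>0 < Y - X\<close>
      by (simp_all add: pos_divide_le_eq pos_divide_less_eq mult.commute[of "Y - X"])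
  qed
  with conv \<open>m_min \<le> real m\<close> show ?thesis by blast
qed

end
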